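(* Assume the Continuum Hypothesis. Fix a $\mu$-null set $H \subseteq 2^\omega$, and suppose there is a family $\mathcal P \subseteq \mathsf{Perf}\times\mathsf{Perf}$ together with binary relations $\{\geq_n : n\in\omega\}$ on $\mathcal P$ such that: (A0) $(\mathcal P, \geq)$ has the fusion property witnessed by $\{\geq_n: n \in \omega\}$; (A1) for every $\mathbf p \in \mathcal P$, $n\in\omega$ and $z\in 2^\omega$ there is $\mathbf q \in \mathcal P$ with $\mathbf q \geq_n \mathbf p$ such that $q_1 \subseteq H+z$ or $q_2 \subseteq H+z$; (A2) for every $\mathbf p\in\mathcal P$, $n \in \omega$, countable $X \subseteq 2^\omega$, $i \in\{1,2\}$ and $t \in \mathsf{Perf}$ with $\mu(t)>0$, $$\mu\Big(\big\{z \in 2^\omega : \exists \mathbf q \in \mathcal P\ \big(\mathbf q \geq_n \mathbf p \text{ and } X\cup(q_i+\mathbb Q) \subseteq t+\mathbb Q+z\big)\big\}\Big)=1.$$ Then the family $\mathcal{SM}$ of strongly meager subsets of $2^\omega$ is not an ideal (i.e. there are strongly meager $X_1,X_2$ with $X_1\cup X_2$ not strongly meager).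
   Context: Work in $2^\omega$ with coordinatewise addition mod 2 and the standard product measure $\mu$. For $A,B\subseteq 2^\omega$ and $z\in 2^\omega$, $A+B=\{a+b:a\in A,b\in B\}$ and $A+z = \{a+z: a\in A\}$. A set $X$ is strongly meager if $X+G\neq 2^\omega$ for every $\mu$-null $G$. Let $\mathbb Q = \{x\in 2^\omega: x(n)=0 \text{ for all but finitely many } n\}$. $\mathsf{Perf}$ is the collection of nonempty perfect subsets of $2^\omega$. Elements of $\mathsf{Perf}\times\mathsf{Perf}$ are written $\mathbf p = (p_1,p_2)$, and $\mathbf p \geq \mathbf q$ means $p_1\subseteq q_1$ and $p_2 \subseteq q_2$. A partial order $(\mathcal P,\geq)$ has the fusion property witnessed by binary relations $\{\geq_n:n\in\omega\}$ (not necessarily transitive) if: (1) $p\geq_n q$ implies $p \geq q$; (2) if $p\geq_{n+1} q$ and $r \geq_{n+1} p$ then $r\geq_n q$; (3) for every sequence $(p_n)_{n\in\omega}$ in $\mathcal P$ with $p_{n+1}\geq_{n+1} p_n$ for all $n$ there is $p_\omega\in\mathcal P$ with $p_\omega \geq_n p_n$ for all $n$. *)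

theory Defs
  imports
    "HOL-Probability.Probability"
    "HOL-Library.Z2"
    "HOL-Library.Function_Algebras"
    "HOL-Library.Set_Algebras"
begin

unbundle cardinal_syntax

instantiation bit :: discrete_topology
begin

definition open_bit :: "bit set \<Rightarrow> bool"
  where "open_bit A \<longleftrightarrow> True"

instance
  by standard (simp_all add: open_bit_def)

end

text \<open>
  Addition on \<open>cantor\<close> is pointwise addition in the two-element field
  (Function_Algebras), the topology is the product topology (Function_Topology), \<open>A + B\<close> is
  the Minkowski sum and \<open>z +o A\<close> is the translate of \<open>A\<close> by \<open>z\<close> (Set_Algebras).
\<close>

type_synonym cantor = "nat \<Rightarrow> bit"

text \<open>
  The measure is completed, so that \<^term>\<open>null_sets cantor_measure\<close> consists of all null
  sets, Borel or not. A set outside the completed sigma-algebra gets \<^const>\<open>emeasure\<close> 0; hence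
  \<open>emeasure cantor_measure A = 1\<close> includes the measurability of \<open>A\<close>.
\<close>

definition cantor_measure :: "cantor measure" where
  "cantor_measure = completion (PiM UNIV (\<lambda>_. uniform_count_measure UNIV))"

definition cantor_rationals :: "cantor set" where
  "cantor_rationals = {x. finite {n. x n \<noteq> 0}}"

definition Perf :: "cantor set set" where
  "Perf = {p. p \<noteq> {} \<and> closed p \<and> (\<forall>x\<in>p. x islimpt p)}"

definition strongly_meager :: "cantor set \<Rightarrow> bool" where
  "strongly_meager X \<longleftrightarrow> (\<forall>G \<in> null_sets cantor_measure. X + G \<noteq> UNIV)"

definition continuum_hypothesis :: bool where
  "continuum_hypothesis \<longleftrightarrow> ctwo ^c natLeq =o cardSuc natLeq"

text \<open>Larger (stronger) pairs have smaller components.\<close>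

definition pair_ge :: "cantor set \<times> cantor set \<Rightarrow> cantor set \<times> cantor set \<Rightarrow> bool" where
  "pair_ge p q \<longleftrightarrow> fst p \<subseteq> fst q \<and> snd p \<subseteq> snd q"

text \<open>
  \<open>ge\<close> is meant to partially order \<open>P\<close>, which is automatic for \<^const>\<open>pair_ge\<close>. Only the
  restrictions of \<open>ge\<close> and \<open>gen n\<close> to \<open>P\<close> matter.
\<close>

definition fusion_property ::
  "'a set \<Rightarrow> ('a \<Rightarrow> 'a \<Rightarrow> bool) \<Rightarrow> (nat \<Rightarrow> 'a \<Rightarrow> 'a \<Rightarrow> bool) \<Rightarrow> bool" where
  "fusion_property P ge gen \<longleftrightarrow>
     (\<forall>n. \<forall>p\<in>P. \<forall>q\<in>P. gen n p q \<longrightarrow> ge p q) \<and>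
     (\<forall>n. \<forall>p\<in>P. \<forall>q\<in>P. \<forall>r\<in>P. gen (Suc n) p q \<and> gen (Suc n) r p \<longrightarrow> gen n r q) \<and>
     (\<forall>s :: nat \<Rightarrow> 'a. (\<forall>n. s n \<in> P) \<and> (\<forall>n. gen (Suc n) (s (Suc n)) (s n)) \<longrightarrow>
        (\<exists>u\<in>P. \<forall>n. gen n u (s n)))"

definition set_ideal :: "'a set set \<Rightarrow> bool" where
  "set_ideal I \<longleftrightarrow>
     {} \<in> I \<and> (\<forall>A\<in>I. \<forall>B. B \<subseteq> A \<longrightarrow> B \<in> I) \<and> (\<forall>A\<in>I. \<forall>B\<in>I. A \<union> B \<in> I)"

end

theory Submission
  imports Defs
begin

text \<open>
  The sets \<open>X1\<close>, \<open>X2\<close> and a null set \<open>H\<close> with \<open>(X1 \<union> X2) + H = UNIV\<close> are built by a recursion along a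
  well-order of the continuum whose initial segments are countable. The coordinates are cut into
  blocks, and \<open>H\<close> consists of the points that fall into a small random set \<open>H k\<close> on infinitely many
  blocks \<open>k\<close>. A condition is a pair of sequences of block sets \<open>(A k, B k)\<close>; later points of \<open>X1\<close>
  (of \<open>X2\<close>) have almost all of their blocks in \<open>A k\<close> (in \<open>B k\<close>), and conditions are refined modulo finitely
  many blocks. Two things must stay possible forever: every \<open>w\<close> must be hit, that is, \<open>A k\<close> or \<open>B k\<close> must
  meet \<open>w + H k\<close> infinitely often, and \<open>A\<close> (or \<open>B\<close>) must be shrinkable into a translate of the complement of
  any null set.

  On a single block this is a finite game. Call \<open>w\<close> bad for a dense set \<open>A\<close> if \<open>A\<close> correlates with the
  deviation \<open>f\<close> of \<open>w + H k\<close> from its mean, measured by \<open>j\<close>-fold averages over cubes. Translates of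
  a random set are so independent that the number of bad \<open>w\<close> is bounded independently of the block length, and
  intersecting \<open>A\<close> with a random translate of an arbitrary set \<open>D\<close> makes any given good \<open>w\<close> bad, one level
  lower, only with small probability. Hence the bad sets of \<open>A\<close> and \<open>B\<close> can be kept disjoint
  for as many moves as the level \<open>j\<close> allows, and levels tend to infinity along the blocks.
\<close>

section \<open>Averages and cube correlations on finite Boolean groups\<close>

text \<open>Why two sets: D may be the complement of H itself, and then cutting A by the translate
  of D by z makes A miss z + H. So some w are lost to A, and B must take them over. When A is cut,
  only the few w that are bad for B are dangerous, so a union bound over them suffices. Why cube
  averages: D comes from an arbitrary null set, so multiplying by a translate of D destroys control
  of any fixed order. Averaged over the translate, however, the squared correlation of order j is
  bounded by the correlation of order j + 1 with D removed. One order is spent per move, and a block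
  that must survive J moves needs an H that is decorrelated up to order J. Why rationals: escaping a
  null set takes one z for infinitely many blocks. Forbidden words of level K + 1 are pushed back to
  level K by keeping only block values with the same fatal set, and compactness passes to the limit.
  This controls the blocks from some k0 on, for one stem. A later point is brought onto that stem by
  a rational translation, which is harmless because the union of countably many translates of a null
  set is null.\<close>

locale finite_boolean_group =
  fixes V :: "'a::ab_group_add set"
  assumes finite_V [simp, intro]: "finite V"
    and zero_V [simp, intro]: "0 \<in> V"
    and add_V [simp, intro]: "x \<in> V \<Longrightarrow> y \<in> V \<Longrightarrow> x + y \<in> V"
    and double_V: "x \<in> V \<Longrightarrow> x + x = 0"
begin

lemma card_pos [simp]: "0 < card V"
  using zero_V finite_V by (metis card_gt_0_iff empty_iff)

lemma V_nonempty [simp]: "V \<noteq> {}"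
  using zero_V by blast

lemma add_cancel_V: "s \<in> V \<Longrightarrow> (x + s) + s = x"
  by (simp add: add.assoc double_V)

lemma bij_betw_shift: "s \<in> V \<Longrightarrow> bij_betw (\<lambda>x. x + s) V V"
  by (rule bij_betwI[where g = "\<lambda>x. x + s"]) (auto simp: add_cancel_V)

lemma bij_betw_shift_left: "s \<in> V \<Longrightarrow> bij_betw (\<lambda>x. s + x) V V"
  using bij_betw_shift[of s] by (simp add: add.commute)

definition avg :: "('a \<Rightarrow> real) \<Rightarrow> real" where
  "avg f = (\<Sum>x\<in>V. f x) / real (card V)"

lemma avg_cong: "(\<And>x. x \<in> V \<Longrightarrow> f x = g x) \<Longrightarrow> avg f = avg g"
  by (simp add: avg_def)

lemma avg_mono: "(\<And>x. x \<in> V \<Longrightarrow> f x \<le> g x) \<Longrightarrow> avg f \<le> avg g"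
  by (simp add: avg_def divide_right_mono sum_mono)

lemma avg_const [simp]: "avg (\<lambda>_. c) = c"
  by (simp add: avg_def)

lemma avg_nonneg: "(\<And>x. x \<in> V \<Longrightarrow> 0 \<le> f x) \<Longrightarrow> 0 \<le> avg f"
  by (simp add: avg_def sum_nonneg)

lemma avg_cmult: "avg (\<lambda>x. c * f x) = c * avg f"
  by (simp add: avg_def sum_distrib_left)

lemma avg_multc: "avg (\<lambda>x. f x * c) = avg f * c"
  by (simp add: avg_def sum_distrib_right)

lemma avg_diff: "avg (\<lambda>x. f x - g x) = avg f - avg g"
  by (simp add: avg_def sum_subtractf diff_divide_distrib)

lemma avg_add: "avg (\<lambda>x. f x + g x) = avg f + avg g"
  by (simp add: avg_def sum.distrib add_divide_distrib)

lemma avg_sum: "avg (\<lambda>x. \<Sum>i\<in>I. f i x) = (\<Sum>i\<in>I. avg (f i))"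
  unfolding avg_def sum_divide_distrib by (subst sum.swap) (rule refl)

lemma avg_swap: "avg (\<lambda>x. avg (\<lambda>y. f x y)) = avg (\<lambda>y. avg (\<lambda>x. f x y))"
  unfolding avg_def sum_divide_distrib[symmetric] by (subst sum.swap) (rule refl)

lemma avg_shift: "s \<in> V \<Longrightarrow> avg (\<lambda>x. f (x + s)) = avg f"
  unfolding avg_def using sum.reindex_bij_betw[OF bij_betw_shift, of s f] by simp

lemma avg_shift_left: "s \<in> V \<Longrightarrow> avg (\<lambda>x. f (s + x)) = avg f"
  using avg_shift[of s f] by (simp add: add.commute)

lemma avg_abs: "\<bar>avg f\<bar> \<le> avg (\<lambda>x. \<bar>f x\<bar>)"
  by (simp add: avg_def divide_right_mono)

lemma avg_square_le: "(avg f)\<^sup>2 \<le> avg (\<lambda>x. (f x)\<^sup>2)"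
proof -
  have "(\<Sum>x\<in>V. f x)\<^sup>2 \<le> (\<Sum>x\<in>V. (f x)\<^sup>2) * real (card V)"
    by (rule sum_squared_le_sum_of_squares)
  then have "(\<Sum>x\<in>V. f x)\<^sup>2 / (real (card V))\<^sup>2
      \<le> ((\<Sum>x\<in>V. (f x)\<^sup>2) * real (card V)) / (real (card V))\<^sup>2"
    by (rule divide_right_mono) simp
  then show ?thesis
    by (simp add: avg_def power_divide power2_eq_square[of "real (card V)"])
qed

lemma avg_square_eq: "(avg f)\<^sup>2 = avg (\<lambda>s. avg (\<lambda>x. f x * f (x + s)))"
proof -
  have "avg (\<lambda>s. avg (\<lambda>x. f x * f (x + s))) = avg (\<lambda>x. avg (\<lambda>s. f x * f (x + s)))"
    by (rule avg_swap)
  also have "\<dots> = avg (\<lambda>x. f x * avg f)"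
    by (rule avg_cong) (simp only: avg_cmult avg_shift_left[of _ f])
  finally show ?thesis by (simp only: avg_multc power2_eq_square)
qed

text \<open>The absolute value sits inside the averages over the j directions and outside the
  average over x, so directions cannot cancel each other.\<close>

primrec corr :: "nat \<Rightarrow> ('a \<Rightarrow> real) \<Rightarrow> real" where
  "corr 0 F = \<bar>avg F\<bar>"
| "corr (Suc j) F = avg (\<lambda>s. corr j (\<lambda>x. F x * F (x + s)))"

text \<open>For j >= 1 this is the 2^j-th power of the Gowers U^j norm. Without absolute values it
  can be averaged exactly over random colourings, which \<open>corr\<close> cannot.\<close>

primrec cube_avg :: "nat \<Rightarrow> ('a \<Rightarrow> real) \<Rightarrow> real" where
  "cube_avg 0 F = avg F"
| "cube_avg (Suc j) F = avg (\<lambda>s. cube_avg j (\<lambda>x. F x * F (x + s)))"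

section \<open>Cauchy-Schwarz inequalities for cube correlations\<close>

lemma corr_cong: "(\<And>x. x \<in> V \<Longrightarrow> F x = F' x) \<Longrightarrow> corr j F = corr j F'"
proof (induction j arbitrary: F F')
  case 0
  then have "avg F = avg F'" by (intro avg_cong)
  then show ?case by simp
next
  case (Suc j)
  have "corr j (\<lambda>x. F x * F (x + s)) = corr j (\<lambda>x. F' x * F' (x + s))" if "s \<in> V" for s
    by (rule Suc.IH) (simp add: Suc.prems that)
  then show ?case unfolding corr.simps by (rule avg_cong)
qed

lemma abs_mult_le_1: "\<bar>a\<bar> \<le> 1 \<Longrightarrow> \<bar>b\<bar> \<le> 1 \<Longrightarrow> \<bar>a * b\<bar> \<le> (1::real)"
  by (simp add: abs_mult mult_le_one)

lemma corr_le_1: "(\<And>x. x \<in> V \<Longrightarrow> \<bar>F x\<bar> \<le> 1) \<Longrightarrow> corr j F \<le> 1"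
proof (induction j arbitrary: F)
  case 0
  have "\<bar>avg F\<bar> \<le> avg (\<lambda>x. \<bar>F x\<bar>)" by (rule avg_abs)
  also have "\<dots> \<le> avg (\<lambda>_. 1)" by (intro avg_mono 0)
  finally show ?case by simp
next
  case (Suc j)
  have "corr (Suc j) F \<le> avg (\<lambda>_. 1)"
    unfolding corr.simps by (intro avg_mono Suc.IH abs_mult_le_1) (auto intro: Suc.prems)
  then show ?case by simp
qed

lemma cube_avg_le_1: "(\<And>x. x \<in> V \<Longrightarrow> \<bar>F x\<bar> \<le> 1) \<Longrightarrow> cube_avg j F \<le> 1"
proof (induction j arbitrary: F)
  case 0
  have "avg F \<le> avg (\<lambda>_. 1)" by (rule avg_mono, rule abs_le_D1, rule 0)
  then show ?case by simp
next
  case (Suc j)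
  have "cube_avg (Suc j) F \<le> avg (\<lambda>_. 1)"
    unfolding cube_avg.simps by (intro avg_mono Suc.IH abs_mult_le_1) (auto intro: Suc.prems)
  then show ?case by simp
qed

lemma corr_shift:
  assumes "w \<in> V"
  shows "corr j (\<lambda>x. F (x + w)) = corr j F"
proof (induction j arbitrary: F)
  case 0
  then show ?case using assms by (simp add: avg_shift[of w F])
next
  case (Suc j)
  have "corr j (\<lambda>x. F (x + w) * F (x + s + w)) = corr j (\<lambda>x. F x * F (x + s))" for s
    using Suc.IH[of "\<lambda>x. F x * F (x + s)"] by (simp only: ac_simps)
  then show ?case by simp
qed

text \<open>Cauchy-Schwarz over the directions moves the square onto the inner mean, and the square
  of a mean is a mean over one further direction, with no absolute value left.\<close>

lemma corr_square_le_cube_avg: "(corr j F)\<^sup>2 \<le> cube_avg (Suc j) F"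
proof (induction j arbitrary: F)
  case 0
  show ?case by (simp only: corr.simps cube_avg.simps power2_abs avg_square_eq order_refl)
next
  case (Suc j)
  have "(corr (Suc j) F)\<^sup>2 \<le> avg (\<lambda>s. (corr j (\<lambda>x. F x * F (x + s)))\<^sup>2)"
    by (simp add: avg_square_le)
  also have "\<dots> \<le> avg (\<lambda>s. cube_avg (Suc j) (\<lambda>x. F x * F (x + s)))"
    by (intro avg_mono Suc.IH)
  finally show ?case by simp
qed

text \<open>Expanding the square pairs x with x + s. Averaging over z then splits off a factor that
  depends on d and s only and is at most 1 in absolute value; what remains is the next order of F.
  For higher j the product \<open>d y * d (y + s)\<close> takes the role of d. Nothing but
  boundedness of d enters, so d may be the indicator of any set.\<close>

lemma avg_corr_mult_shift_le:
  assumes "\<And>x. x \<in> V \<Longrightarrow> \<bar>d x\<bar> \<le> 1"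
  shows "avg (\<lambda>z. (corr j (\<lambda>x. F x * d (x + z)))\<^sup>2) \<le> corr (Suc j) F"
  using assms
proof (induction j arbitrary: F d)
  case 0
  have "avg (\<lambda>z. (corr 0 (\<lambda>x. F x * d (x + z)))\<^sup>2)
      = avg (\<lambda>z. avg (\<lambda>s. avg (\<lambda>x. (F x * F (x + s)) * (d (x + z) * d (x + s + z)))))"
    by (simp only: corr.simps power2_abs avg_square_eq ac_simps)
  also have "\<dots> = avg (\<lambda>s. avg (\<lambda>z. avg (\<lambda>x. (F x * F (x + s)) * (d (x + z) * d (x + s + z)))))"
    by (rule avg_swap)
  also have "\<dots> = avg (\<lambda>s. avg (\<lambda>x. avg (\<lambda>z. (F x * F (x + s)) * (d (x + z) * d (x + s + z)))))"
    by (intro avg_cong avg_swap)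
  also have "\<dots> = avg (\<lambda>s. avg (\<lambda>x. (F x * F (x + s)) * avg (\<lambda>y. d y * d (y + s))))"
  proof (intro avg_cong)
    fix s x assume "s \<in> V" "x \<in> V"
    have "avg (\<lambda>z. d (x + z) * d (x + s + z)) = avg (\<lambda>y. d y * d (y + s))"
      using avg_shift_left[OF \<open>x \<in> V\<close>, of "\<lambda>y. d y * d (y + s)"] by (simp only: ac_simps)
    then show "avg (\<lambda>z. (F x * F (x + s)) * (d (x + z) * d (x + s + z)))
        = (F x * F (x + s)) * avg (\<lambda>y. d y * d (y + s))"
      by (simp only: avg_cmult)
  qed
  also have "\<dots> \<le> avg (\<lambda>s. \<bar>avg (\<lambda>x. F x * F (x + s))\<bar>)"
  proof (rule avg_mono)
    fix s assume s: "s \<in> V"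
    have "\<bar>avg (\<lambda>y. d y * d (y + s))\<bar> \<le> 1"
      using corr_le_1[of "\<lambda>y. d y * d (y + s)" 0] abs_mult_le_1[OF 0 0] s by auto
    then have "\<bar>avg (\<lambda>x. F x * F (x + s))\<bar> * \<bar>avg (\<lambda>y. d y * d (y + s))\<bar> \<le> \<bar>avg (\<lambda>x. F x * F (x + s))\<bar>"
      by (intro mult_left_le) auto
    moreover have "avg (\<lambda>x. (F x * F (x + s)) * avg (\<lambda>y. d y * d (y + s)))
      \<le> \<bar>avg (\<lambda>x. F x * F (x + s))\<bar> * \<bar>avg (\<lambda>y. d y * d (y + s))\<bar>"
      unfolding avg_multc abs_mult[symmetric] by (rule abs_ge_self)
    ultimately show "avg (\<lambda>x. (F x * F (x + s)) * avg (\<lambda>y. d y * d (y + s))) \<le> \<bar>avg (\<lambda>x. F x * F (x + s))\<bar>"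
      by linarith
  qed
  finally show ?case by simp
next
  case (Suc j)
  have "avg (\<lambda>z. (corr (Suc j) (\<lambda>x. F x * d (x + z)))\<^sup>2)
      \<le> avg (\<lambda>z. avg (\<lambda>s. (corr j (\<lambda>x. (F x * F (x + s)) * (d (x + z) * d (x + z + s))))\<^sup>2))"
    unfolding corr.simps
    by (rule avg_mono, rule order_trans[OF avg_square_le]) (simp only: ac_simps order_refl)
  also have "\<dots> = avg (\<lambda>s. avg (\<lambda>z. (corr j (\<lambda>x. (F x * F (x + s)) * (d (x + z) * d (x + z + s))))\<^sup>2))"
    by (rule avg_swap)
  also have "\<dots> \<le> avg (\<lambda>s. corr (Suc j) (\<lambda>x. F x * F (x + s)))"
    by (rule avg_mono, rule Suc.IH[where d = "\<lambda>y. d y * d (y + s)" for s]) (auto intro: abs_mult_le_1 Suc.prems)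
  finally show ?case by simp
qed

lemma corr_square_le_Suc: "(corr j F)\<^sup>2 \<le> corr (Suc j) F"
  using avg_corr_mult_shift_le[of "\<lambda>_. 1" j F] by simp

text \<open>Duality: inserting the signs of the means turns the sum into one mean over x, and
  Cauchy-Schwarz then removes the unknown weight a. In the induction a is replaced by
  \<open>a x * a (x + s)\<close>, which is bounded again.\<close>

lemma sum_corr_square_le:
  assumes "\<And>x. x \<in> V \<Longrightarrow> \<bar>a x\<bar> \<le> 1"
  shows "(\<Sum>w\<in>W. corr j (\<lambda>x. a x * F w x))\<^sup>2 \<le> (\<Sum>w\<in>W. \<Sum>w'\<in>W. corr j (\<lambda>x. F w x * F w' x))"
  using assms
proof (induction j arbitrary: a F)
  case 0
  define u where "u w = sgn (avg (\<lambda>x. a x * F w x))" for w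
  have u: "\<bar>u w\<bar> \<le> 1" for w by (simp add: u_def sgn_real_def)
  have "(\<Sum>w\<in>W. corr 0 (\<lambda>x. a x * F w x)) = (\<Sum>w\<in>W. u w * avg (\<lambda>x. a x * F w x))"
    by (intro sum.cong) (auto simp: u_def sgn_real_def)
  also have "\<dots> = avg (\<lambda>x. a x * (\<Sum>w\<in>W. u w * F w x))"
    unfolding sum_distrib_left avg_sum avg_cmult[symmetric] by (simp only: ac_simps)
  also have "\<dots>\<^sup>2 \<le> avg (\<lambda>x. (a x * (\<Sum>w\<in>W. u w * F w x))\<^sup>2)" by (rule avg_square_le)
  also have "\<dots> \<le> avg (\<lambda>x. (\<Sum>w\<in>W. u w * F w x)\<^sup>2)"
  proof (rule avg_mono)
    fix x assume "x \<in> V"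
    then have "(a x)\<^sup>2 \<le> 1" using 0 by (simp add: abs_square_le_1)
    then show "(a x * (\<Sum>w\<in>W. u w * F w x))\<^sup>2 \<le> (\<Sum>w\<in>W. u w * F w x)\<^sup>2"
      unfolding power_mult_distrib by (intro mult_left_le_one_le) auto
  qed
  also have "\<dots> = (\<Sum>w\<in>W. \<Sum>w'\<in>W. (u w * u w') * avg (\<lambda>x. F w x * F w' x))"
    unfolding power2_eq_square sum_product avg_sum avg_cmult[symmetric] by (simp only: ac_simps)
  also have "\<dots> \<le> (\<Sum>w\<in>W. \<Sum>w'\<in>W. \<bar>avg (\<lambda>x. F w x * F w' x)\<bar>)"
  proof (intro sum_mono)
    fix w w'
    have "\<bar>u w * u w'\<bar> \<le> 1" by (intro abs_mult_le_1 u)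
    then have "\<bar>u w * u w'\<bar> * \<bar>avg (\<lambda>x. F w x * F w' x)\<bar> \<le> 1 * \<bar>avg (\<lambda>x. F w x * F w' x)\<bar>"
      by (rule mult_right_mono) simp
    then show "(u w * u w') * avg (\<lambda>x. F w x * F w' x) \<le> \<bar>avg (\<lambda>x. F w x * F w' x)\<bar>"
      using abs_ge_self[of "(u w * u w') * avg (\<lambda>x. F w x * F w' x)"] by (simp only: abs_mult)
  qed
  finally show ?case by simp
next
  case (Suc j)
  have "(\<Sum>w\<in>W. corr (Suc j) (\<lambda>x. a x * F w x))\<^sup>2
     = (avg (\<lambda>s. \<Sum>w\<in>W. corr j (\<lambda>x. (a x * a (x + s)) * (F w x * F w (x + s)))))\<^sup>2"
    unfolding corr.simps avg_sum by (simp only: ac_simps)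
  also have "\<dots> \<le> avg (\<lambda>s. (\<Sum>w\<in>W. corr j (\<lambda>x. (a x * a (x + s)) * (F w x * F w (x + s))))\<^sup>2)"
    by (rule avg_square_le)
  also have "\<dots> \<le> avg (\<lambda>s. \<Sum>w\<in>W. \<Sum>w'\<in>W. corr j (\<lambda>x. (F w x * F w (x + s)) * (F w' x * F w' (x + s))))"
    by (rule avg_mono, rule Suc.IH[where a = "\<lambda>x. a x * a (x + s)" for s]) (auto intro: abs_mult_le_1 Suc.prems)
  also have "\<dots> = (\<Sum>w\<in>W. \<Sum>w'\<in>W. corr (Suc j) (\<lambda>x. F w x * F w' x))"
    unfolding corr.simps avg_sum by (simp only: ac_simps)
  finally show ?case .
qed

end

section \<open>Random sets with decorrelated translates\<close>

lemma prod_list_map_eq_prod_count: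
  fixes f :: "'a \<Rightarrow> 'b::comm_monoid_mult"
  assumes "finite X" "set xs \<subseteq> X"
  shows "prod_list (map f xs) = (\<Prod>x\<in>X. f x ^ count_list xs x)"
  using assms(2)
proof (induction xs)
  case Nil
  then show ?case by simp
next
  case (Cons y xs)
  have "(\<Prod>x\<in>X. f x ^ count_list (y # xs) x) = (\<Prod>x\<in>X. (if x = y then f x else 1) * f x ^ count_list xs x)"
    by (rule prod.cong) auto
  also have "\<dots> = f y * (\<Prod>x\<in>X. f x ^ count_list xs x)"
    using Cons.prems assms(1) by (simp add: prod.distrib prod.delta)
  finally show ?case using Cons by simp
qed

context finite_boolean_group
begin

text \<open>A uniform colouring g encodes a random set of density 1 / R, the points of colour 0.
  Counting colourings replaces probability.\<close>

definition centred :: "nat \<Rightarrow> ('a \<Rightarrow> nat) \<Rightarrow> 'a \<Rightarrow> real" where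
  "centred R g x = of_bool (g x = 0) - 1 / real R"

text \<open>A list rather than a set of shifts: vertices of a cube may coincide, and the expectation
  is known to vanish only if some vertex occurs exactly once.\<close>

definition shift_prod :: "('a \<Rightarrow> real) \<Rightarrow> 'a list \<Rightarrow> 'a \<Rightarrow> real" where
  "shift_prod f L x = prod_list (map (\<lambda>u. f (x + u)) L)"

abbreviation colourings :: "nat \<Rightarrow> ('a \<Rightarrow> nat) set" where
  "colourings R \<equiv> V \<rightarrow>\<^sub>E {..<R}"

lemma abs_centred_le_1: "R \<ge> 1 \<Longrightarrow> \<bar>centred R g x\<bar> \<le> 1"
  by (simp add: centred_def divide_simps)

lemma abs_shift_prod_le_1:
  assumes "\<And>x. \<bar>f x\<bar> \<le> 1"
  shows "\<bar>shift_prod f L x\<bar> \<le> 1"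
  unfolding shift_prod_def by (induction L) (use assms in \<open>auto intro!: abs_mult_le_1\<close>)

lemma shift_prod_mult_shift:
  "shift_prod f L x * shift_prod f L (x + s) = shift_prod f (L @ map ((+) s) L) x"
  by (simp add: shift_prod_def o_def add.assoc)

lemma sum_centred_colours: "R \<ge> 1 \<Longrightarrow> (\<Sum>c<R. of_bool (c = 0) - 1 / real R) = 0"
  by (simp add: sum_subtractf of_bool_def sum.delta)

text \<open>The sum over colourings factors over the points of V. The point x occurs exactly once,
  through the shift 0, so its factor is the sum of a centred variable.\<close>

lemma sum_shift_prod_centred_eq_0:
  assumes R: "R \<ge> 1" and x: "x \<in> V" and L: "set L \<subseteq> V" "0 \<notin> set L"
  shows "(\<Sum>g\<in>colourings R. shift_prod (centred R g) (0 # L) x) = 0"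
proof -
  define cnt where "cnt = count_list (map ((+) x) (0 # L))"
  have sub: "set (map ((+) x) (0 # L)) \<subseteq> V" using x L by auto
  have "shift_prod (centred R g) (0 # L) x = (\<Prod>y\<in>V. (of_bool (g y = 0) - 1 / real R) ^ cnt y)" for g
    using prod_list_map_eq_prod_count[OF finite_V sub, of "centred R g"]
    by (simp only: shift_prod_def cnt_def centred_def map_map o_def)
  then have "(\<Sum>g\<in>colourings R. shift_prod (centred R g) (0 # L) x)
      = (\<Sum>g\<in>colourings R. \<Prod>y\<in>V. (of_bool (g y = 0) - 1 / real R) ^ cnt y)"
    by simp
  also have "\<dots> = (\<Prod>y\<in>V. \<Sum>c<R. (of_bool (c = 0) - 1 / real R) ^ cnt y)"
    by (rule prod_sum_PiE[symmetric]) auto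
  also have "\<dots> = 0"
  proof (rule prod_zero)
    have "x \<notin> set (map ((+) x) L)" using L by auto
    then have "cnt x = 1" by (simp add: cnt_def count_list_0_iff)
    then show "\<exists>y\<in>V. (\<Sum>c<R. (of_bool (c = 0) - 1 / real R) ^ cnt y) = 0"
      using x sum_centred_colours[OF R] by (intro bexI[of _ x]) simp_all
  qed simp
  finally show ?thesis .
qed

lemma sum_avg: "(\<Sum>g\<in>S. avg (\<lambda>s. f g s)) = avg (\<lambda>s. \<Sum>g\<in>S. f g s)"
  by (rule avg_sum[symmetric])

text \<open>Write l for \<open>Suc (length L)\<close>. A new direction s doubles the list. Unless s
  is among the l old shifts, the shift 0 still occurs once and the induction hypothesis applies with
  2 l; the exceptional s contribute at most l / |V|. The recurrence b (j + 1) l = b j (2 l) + l /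
  |V| gives the factor 2^j - 1.\<close>

lemma sum_cube_avg_shift_prod_le:
  assumes R: "R \<ge> 1" and L: "set L \<subseteq> V" "0 \<notin> set L"
  shows "(\<Sum>g\<in>colourings R. cube_avg j (shift_prod (centred R g) (0 # L)))
    \<le> real (card (colourings R)) * ((2 ^ j - 1) * real (Suc (length L)) / real (card V))"
  using L
proof (induction j arbitrary: L)
  case 0
  have "(\<Sum>g\<in>colourings R. cube_avg 0 (shift_prod (centred R g) (0 # L))) = avg (\<lambda>_. 0)"
    unfolding cube_avg.simps sum_avg
    by (rule avg_cong, rule sum_shift_prod_centred_eq_0) (use 0 R in auto)
  then show ?case by simp
next
  case (Suc j)
  let ?S = "colourings R"
  let ?F = "\<lambda>g. shift_prod (centred R g)"
  let ?c = "real (card ?S)" and ?l = "real (Suc (length L))" and ?N = "real (card V)"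
  define L' where "L' s = L @ s # map ((+) s) L" for s
  define b where "b = ?c * ((2 ^ j - 1) * (2 * ?l) / ?N)"
  have b: "b \<ge> 0" unfolding b_def by simp
  have "(\<Sum>g\<in>?S. cube_avg (Suc j) (?F g (0 # L))) = avg (\<lambda>s. \<Sum>g\<in>?S. cube_avg j (?F g (0 # L' s)))"
    unfolding cube_avg.simps sum_avg shift_prod_mult_shift by (simp add: L'_def)
  also have "\<dots> \<le> avg (\<lambda>s. b + ?c * of_bool (s \<in> set (0 # L)))"
  proof (rule avg_mono)
    fix s assume s: "s \<in> V"
    show "(\<Sum>g\<in>?S. cube_avg j (?F g (0 # L' s))) \<le> b + ?c * of_bool (s \<in> set (0 # L))"
    proof (cases "s \<in> set (0 # L)")
      case True
      have "(\<Sum>g\<in>?S. cube_avg j (?F g (0 # L' s))) \<le> (\<Sum>g\<in>?S. 1)"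
        by (intro sum_mono cube_avg_le_1 abs_shift_prod_le_1 abs_centred_le_1 R)
      then show ?thesis using True b by simp
    next
      case False
      have "s + u \<noteq> 0" if "u \<in> set L" for u
      proof
        assume "s + u = 0"
        then have "s = u" using add_cancel_V[of u s] that Suc.prems by (metis add_0 subsetD)
        then show False using that False by simp
      qed
      then have "0 \<notin> set (L' s)" using False Suc.prems by (force simp: L'_def)
      moreover have "set (L' s) \<subseteq> V" using s Suc.prems by (auto simp: L'_def)
      ultimately have "(\<Sum>g\<in>?S. cube_avg j (?F g (0 # L' s)))
          \<le> ?c * ((2 ^ j - 1) * real (Suc (length (L' s))) / ?N)"
        by (intro Suc.IH)
      then show ?thesis using False by (simp add: L'_def b_def algebra_simps)
    qed
  qed
  also have "\<dots> = b + ?c * avg (\<lambda>s. of_bool (s \<in> set (0 # L)))"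
    by (simp only: avg_add avg_const avg_cmult)
  also have "\<dots> \<le> b + ?c * (?l / ?N)"
  proof -
    have "(\<Sum>s\<in>V. of_bool (s \<in> set (0 # L))) = real (card (V \<inter> set (0 # L)))"
      by (simp add: of_bool_def sum.If_cases del: list.set)
    also have "\<dots> \<le> real (card (set (0 # L)))" by (intro of_nat_mono card_mono) auto
    also have "\<dots> \<le> ?l" using card_length[of "0 # L"] by simp
    finally have "avg (\<lambda>s. of_bool (s \<in> set (0 # L))) \<le> ?l / ?N"
      unfolding avg_def by (rule divide_right_mono) simp
    then show ?thesis by (intro add_left_mono mult_left_mono) auto
  qed
  also have "\<dots> = ?c * ((2 ^ Suc j - 1) * ?l / ?N)"
    unfolding b_def by (simp add: field_simps)
  finally show ?case .
qed

text \<open>A sum over s, not a mean: C does not grow with V, and this is what bounds the number of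
  bad translates independently of the block length.\<close>

definition decorrelated :: "nat \<Rightarrow> real \<Rightarrow> ('a \<Rightarrow> real) \<Rightarrow> bool" where
  "decorrelated J C f \<longleftrightarrow> (\<forall>j\<le>J. (\<Sum>s\<in>V. (corr j (\<lambda>x. f x * f (x + s)))\<^sup>2) \<le> C)"

text \<open>Per colouring, s = 0 contributes at most 1 and every other s on average at most 2
  (2^(j+1) - 1) / |V|, so |V| cancels from the sum.\<close>

lemma sum_corr_centred_le:
  assumes R: "R \<ge> 1"
  shows "(\<Sum>g\<in>colourings R. \<Sum>s\<in>V. (corr j (\<lambda>x. centred R g x * centred R g (x + s)))\<^sup>2)
    \<le> real (card (colourings R)) * 2 ^ (j + 3)"
proof -
  let ?S = "colourings R" and ?N = "real (card V)"
  let ?c = "real (card ?S)"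
  have eq: "(\<lambda>x. centred R g x * centred R g (x + s)) = shift_prod (centred R g) [0, s]" for g s
    by (simp add: shift_prod_def fun_eq_iff)
  have "(\<Sum>g\<in>?S. \<Sum>s\<in>V. (corr j (\<lambda>x. centred R g x * centred R g (x + s)))\<^sup>2)
      \<le> (\<Sum>g\<in>?S. \<Sum>s\<in>V. cube_avg (Suc j) (shift_prod (centred R g) [0, s]))"
    unfolding eq by (intro sum_mono corr_square_le_cube_avg)
  also have "\<dots> = (\<Sum>s\<in>V. \<Sum>g\<in>?S. cube_avg (Suc j) (shift_prod (centred R g) [0, s]))"
    by (rule sum.swap)
  also have "\<dots> \<le> (\<Sum>s\<in>V. ?c * ((2 ^ Suc j - 1) * 2 / ?N) + (if s = 0 then ?c else 0))"
  proof (rule sum_mono)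
    fix s assume s: "s \<in> V"
    show "(\<Sum>g\<in>?S. cube_avg (Suc j) (shift_prod (centred R g) [0, s]))
        \<le> ?c * ((2 ^ Suc j - 1) * 2 / ?N) + (if s = 0 then ?c else 0)"
    proof (cases "s = 0")
      case True
      have "(\<Sum>g\<in>?S. cube_avg (Suc j) (shift_prod (centred R g) [0, s])) \<le> (\<Sum>g\<in>?S. 1)"
        by (intro sum_mono cube_avg_le_1 abs_shift_prod_le_1 abs_centred_le_1 R)
      moreover have "(1::real) \<le> 2 ^ Suc j" by (rule one_le_power) simp
      then have "(2 ^ Suc j - 1) * 2 / ?N \<ge> 0"
        by (intro divide_nonneg_nonneg mult_nonneg_nonneg) auto
      ultimately show ?thesis using True by (simp add: add_increasing del: power_Suc)
    next
      case False
      then show ?thesis using sum_cube_avg_shift_prod_le[OF R, of "[s]" "Suc j"] s by simp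
    qed
  qed
  also have "\<dots> = ?N * (?c * ((2 ^ Suc j - 1) * 2 / ?N)) + ?c"
    by (simp add: sum.distrib sum.delta del: power_Suc)
  also have "\<dots> = ?c * ((2 ^ Suc j - 1) * 2 + 1)"
    by (simp add: field_simps)
  also have "\<dots> \<le> ?c * 2 ^ (j + 3)"
  proof (rule mult_left_mono)
    have "(- 1::real) \<le> 4 * 2 ^ j" by (rule order_trans[of _ 0]) simp_all
    then show "(2 ^ Suc j - 1) * 2 + 1 \<le> (2::real) ^ (j + 3)"
      by (simp add: power_add)
  qed simp
  finally show ?thesis .
qed

text \<open>First moment: the mean over colourings of R times the density of H, plus
  \<open>T g / D\<close>, is at most 2. Both summands are nonnegative, so a single colouring bounds
  both by 2. The second factor 2 turns 2^(J+3) into 2^(J+4).\<close>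

lemma exists_decorrelated_set:
  assumes R: "R \<ge> 1"
  obtains H where "H \<subseteq> V" "real (card H) * real R \<le> 2 * real (card V)"
    "decorrelated J (real (Suc J) * 2 ^ (J + 4)) (\<lambda>x. of_bool (x \<in> H) - 1 / real R)"
proof -
  let ?S = "colourings R" and ?N = "real (card V)"
  let ?c = "real (card ?S)"
  define D where "D = real (Suc J) * 2 ^ (J + 3)"
  define T where "T g = (\<Sum>j\<le>J. \<Sum>s\<in>V. (corr j (\<lambda>x. centred R g x * centred R g (x + s)))\<^sup>2)" for g
  have D: "D > 0" by (simp add: D_def)
  have fin: "finite ?S" by (intro finite_PiE) auto
  have ne: "?S \<noteq> {}" using R by (auto simp: PiE_eq_empty_iff lessThan_empty_iff)
  have "(\<Sum>g\<in>?S. T g) = (\<Sum>j\<le>J. \<Sum>g\<in>?S. \<Sum>s\<in>V. (corr j (\<lambda>x. centred R g x * centred R g (x + s)))\<^sup>2)"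
    unfolding T_def by (rule sum.swap)
  also have "\<dots> \<le> (\<Sum>j\<le>J. ?c * 2 ^ (J + 3))"
    by (rule sum_mono, rule order_trans[OF sum_corr_centred_le[OF R]])
      (auto intro!: mult_left_mono power_increasing)
  also have "\<dots> = ?c * D" by (simp add: D_def)
  finally have T: "(\<Sum>g\<in>?S. T g / D) \<le> ?c"
    using D by (simp add: divide_simps flip: sum_divide_distrib)
  have "(\<Sum>g\<in>?S. avg (centred R g)) = (\<Sum>g\<in>?S. cube_avg 0 (shift_prod (centred R g) [0]))"
    by (simp add: shift_prod_def[abs_def])
  also have "\<dots> \<le> 0" using sum_cube_avg_shift_prod_le[OF R, of "[]" 0] by simp
  finally have "real R * (\<Sum>g\<in>?S. avg (centred R g)) \<le> 0"
    by (simp add: mult_nonneg_nonpos)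
  then have "(\<Sum>g\<in>?S. real R * avg (centred R g) + 1 + T g / D) \<le> (\<Sum>g\<in>?S. 2)"
    using T by (simp add: sum.distrib flip: sum_distrib_left)
  then have "\<not> (\<Sum>g\<in>?S. 2) < (\<Sum>g\<in>?S. real R * avg (centred R g) + 1 + T g / D)"
    by (simp only: not_less)
  then obtain g where g: "g \<in> ?S" "real R * avg (centred R g) + 1 + T g / D \<le> 2"
    using sum_strict_mono[OF fin ne, of "\<lambda>_. 2" "\<lambda>g. real R * avg (centred R g) + 1 + T g / D"]
    by (meson not_le)
  define H where "H = {x \<in> V. g x = 0}"
  have cen: "centred R g x = of_bool (x \<in> H) - 1 / real R" if "x \<in> V" for x
    using that by (simp add: centred_def H_def)
  have "(\<Sum>x\<in>V. of_bool (g x = 0)) = real (card H)"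
    by (simp add: of_bool_def sum.If_cases H_def Int_def)
  then have "avg (centred R g) = real (card H) / ?N - 1 / real R"
    unfolding centred_def avg_diff by (simp add: avg_def)
  then have avgH: "real R * avg (centred R g) + 1 = real (card H) * real R / ?N"
    using R by (simp add: field_simps)
  have T0: "T g \<ge> 0" unfolding T_def by (intro sum_nonneg) auto
  then have "T g / D \<ge> 0" using D by simp
  then have 1: "real (card H) * real R \<le> 2 * ?N"
  proof -
    have "real (card H) * real R / ?N \<le> 2" using g avgH \<open>T g / D \<ge> 0\<close> by linarith
    then show ?thesis by (simp add: pos_divide_le_eq)
  qed
  have "real (card H) * real R / ?N \<ge> 0" by simp
  then have "T g / D \<le> 2" using g avgH by linarith
  then have T2: "T g \<le> 2 * D" using D by (simp add: divide_simps)
  have "decorrelated J (2 * D) (\<lambda>x. of_bool (x \<in> H) - 1 / real R)"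
    unfolding decorrelated_def
  proof (intro allI impI)
    fix j assume j: "j \<le> J"
    have "(\<Sum>s\<in>V. (corr j (\<lambda>x. (of_bool (x \<in> H) - 1 / real R) * (of_bool (x + s \<in> H) - 1 / real R)))\<^sup>2)
        = (\<Sum>s\<in>V. (corr j (\<lambda>x. centred R g x * centred R g (x + s)))\<^sup>2)"
    proof (rule sum.cong[OF refl])
      fix s assume "s \<in> V"
      then have "corr j (\<lambda>x. (of_bool (x \<in> H) - 1 / real R) * (of_bool (x + s \<in> H) - 1 / real R))
          = corr j (\<lambda>x. centred R g x * centred R g (x + s))"
        by (intro corr_cong) (simp add: cen)
      then show "(corr j (\<lambda>x. (of_bool (x \<in> H) - 1 / real R) * (of_bool (x + s \<in> H) - 1 / real R)))\<^sup>2
          = (corr j (\<lambda>x. centred R g x * centred R g (x + s)))\<^sup>2" by simp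
    qed
    also have "\<dots> \<le> T g"
      unfolding T_def using j by (intro member_le_sum) (auto intro: sum_nonneg)
    finally show "(\<Sum>s\<in>V. (corr j (\<lambda>x. (of_bool (x \<in> H) - 1 / real R) * (of_bool (x + s \<in> H) - 1 / real R)))\<^sup>2) \<le> 2 * D"
      using T2 by linarith
  qed
  moreover have "2 * D = real (Suc J) * 2 ^ (J + 4)" by (simp add: D_def power_add)
  ultimately show ?thesis using that[of H] 1 by (auto simp: H_def)
qed

text \<open>With M bad shifts, duality bounds (M \<theta>)^2 by a sum over pairs that depends on w +
  w' only. Cauchy-Schwarz over the M^2 pairs, with at most C for each fixed w, gives (M \<theta>)^4
  \<le> M^3 C, hence the power 4.\<close>

lemma card_correlated_shifts_le:
  assumes f: "decorrelated J C f" "j \<le> J" and a: "\<And>x. x \<in> V \<Longrightarrow> \<bar>a x\<bar> \<le> 1"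
    and W: "W \<subseteq> V" "\<And>w. w \<in> W \<Longrightarrow> \<theta> < corr j (\<lambda>x. a x * f (x + w))" and \<theta>: "0 \<le> \<theta>"
  shows "real (card W) * \<theta> ^ 4 \<le> C"
proof (cases "card W = 0")
  case True
  have "0 \<le> (\<Sum>s\<in>V. (corr j (\<lambda>x. f x * f (x + s)))\<^sup>2)" by (intro sum_nonneg) auto
  then show ?thesis using True f unfolding decorrelated_def by force
next
  case False
  define M where "M = real (card W)"
  have M: "M > 0" using False by (simp add: M_def)
  define q where "q s = corr j (\<lambda>x. f x * f (x + s))" for s
  have q: "corr j (\<lambda>x. f (x + w) * f (x + w')) = q (w + w')" if "w \<in> V" "w' \<in> V" for w w'
  proof -
    have "x + w + (w + w') = x + w'" for x
      using add_cancel_V[OF that(1), of x] by (simp add: add.assoc[symmetric])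
    then show ?thesis
      using corr_shift[OF that(1), of j "\<lambda>x. f x * f (x + (w + w'))"] by (simp only: q_def)
  qed
  have "M * \<theta> \<le> (\<Sum>w\<in>W. corr j (\<lambda>x. a x * f (x + w)))"
    unfolding M_def using W(2) by (intro sum_bounded_below less_imp_le)
  then have "(M * \<theta>)\<^sup>2 \<le> (\<Sum>w\<in>W. corr j (\<lambda>x. a x * f (x + w)))\<^sup>2"
    using M \<theta> by (intro power_mono) auto
  also have "\<dots> \<le> (\<Sum>w\<in>W. \<Sum>w'\<in>W. corr j (\<lambda>x. f (x + w) * f (x + w')))"
    by (rule sum_corr_square_le[OF a])
  also have "\<dots> = (\<Sum>w\<in>W. \<Sum>w'\<in>W. q (w + w'))"
    using W(1) by (intro sum.cong refl q) auto
  also have "\<dots> = (\<Sum>p\<in>W \<times> W. q (fst p + snd p))"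
    by (simp add: sum.cartesian_product case_prod_unfold)
  finally have 1: "(M * \<theta>)\<^sup>2 \<le> (\<Sum>p\<in>W \<times> W. q (fst p + snd p))" .
  have "(M * \<theta>) ^ 4 = ((M * \<theta>)\<^sup>2)\<^sup>2" by simp
  also have "\<dots> \<le> (\<Sum>p\<in>W \<times> W. q (fst p + snd p))\<^sup>2"
    using 1 by (intro power_mono) auto
  also have "\<dots> \<le> (\<Sum>p\<in>W \<times> W. (q (fst p + snd p))\<^sup>2) * real (card (W \<times> W))"
    by (rule sum_squared_le_sum_of_squares)
  also have "\<dots> = (\<Sum>w\<in>W. \<Sum>w'\<in>W. (q (w + w'))\<^sup>2) * M\<^sup>2"
    by (simp add: sum.cartesian_product case_prod_unfold card_cartesian_product M_def power2_eq_square)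
  also have "\<dots> \<le> (\<Sum>w\<in>W. C) * M\<^sup>2"
  proof (intro mult_right_mono sum_mono)
    fix w assume w: "w \<in> W"
    have "(\<Sum>w'\<in>W. (q (w + w'))\<^sup>2) \<le> (\<Sum>w'\<in>V. (q (w + w'))\<^sup>2)"
      using W(1) by (intro sum_mono2) auto
    also have "\<dots> = (\<Sum>s\<in>V. (q s)\<^sup>2)"
      using sum.reindex_bij_betw[OF bij_betw_shift_left, of w "\<lambda>s. (q s)\<^sup>2"] w W(1) by auto
    also have "\<dots> \<le> C" using f unfolding decorrelated_def q_def by blast
    finally show "(\<Sum>w'\<in>W. (q (w + w'))\<^sup>2) \<le> C" .
  qed simp
  also have "\<dots> = M ^ 3 * C" by (simp add: M_def power3_eq_cube power2_eq_square)
  also have "(M * \<theta>) ^ 4 = M ^ 3 * (M * \<theta> ^ 4)"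
    by (simp add: eval_nat_numeral algebra_simps)
  finally have "M ^ 3 * (M * \<theta> ^ 4) \<le> M ^ 3 * C" .
  then show ?thesis using M by (simp add: M_def mult_le_cancel_left_pos)
qed

end

section \<open>The translation game\<close>

text \<open>The index j counts the moves that are still possible. Symmetry lets the second clause
  speak of cutting the first set only. Translates whose cut keeps less than the fraction
  \<open>\<tau>\<close> of A are not counted as failures; thickness will come from the choice of a
  popular type.\<close>

definition translation_game ::
  "'a::ab_group_add set \<Rightarrow> 'a set \<Rightarrow> real \<Rightarrow> real \<Rightarrow> (nat \<Rightarrow> 'a set \<Rightarrow> 'a set \<Rightarrow> bool) \<Rightarrow> bool" where
  "translation_game V H \<tau> \<xi> good \<longleftrightarrow>
    (\<forall>j A B. good j A B \<longrightarrow> A \<noteq> {} \<and> A \<subseteq> V \<and> good j B A \<and>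
      (\<forall>w\<in>V. (\<exists>x\<in>A. x + w \<in> H) \<or> (\<exists>x\<in>B. x + w \<in> H))) \<and>
    (\<forall>j A B D. good (Suc j) A B \<longrightarrow>
      real (card {z \<in> V. \<tau> * real (card A) \<le> real (card {x \<in> A. x + z \<in> D}) \<and>
        \<not> good j {x \<in> A. x + z \<in> D} B}) \<le> \<xi> * real (card V))"

context finite_boolean_group
begin

lemma avg_indicator: "A \<subseteq> V \<Longrightarrow> avg (\<lambda>x. of_bool (x \<in> A)) = real (card A) / real (card V)"
  by (simp add: avg_def of_bool_def sum.If_cases Int_absorb1)

lemma card_gt_mult_le:
  assumes "\<And>z. z \<in> V \<Longrightarrow> 0 \<le> f z" "0 \<le> c"
  shows "real (card {z \<in> V. c < f z}) * c \<le> real (card V) * avg f"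
proof -
  have "real (card {z \<in> V. c < f z}) * c = (\<Sum>z\<in>{z \<in> V. c < f z}. c)" by simp
  also have "\<dots> \<le> (\<Sum>z\<in>{z \<in> V. c < f z}. f z)" by (intro sum_mono) auto
  also have "\<dots> \<le> (\<Sum>z\<in>V. f z)" using assms by (intro sum_mono2) auto
  finally show ?thesis by (simp add: avg_def)
qed

text \<open>A pair is good at level j if both densities are at least \<tau>^(J - j) and no w
  correlates above \<open>\<theta> j\<close> with both sets. The exponent 6 in
  \<open>\<theta>_Suc\<close>: at most C / \<theta>_j^4 many w are bad for B, each turns bad for the
  cut set for a fraction at most \<theta>_(j+1) / \<theta>_j^2 of the translates, and the product is
  \<xi>.\<close>

lemma exists_good_relation:
  fixes R J :: nat and \<tau> \<xi> C :: real and \<theta> :: "nat \<Rightarrow> real"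
  assumes R: "R \<ge> 1" and \<tau>: "0 < \<tau>" "\<tau> \<le> 1" and \<xi>: "0 < \<xi>" "\<xi> \<le> 1" and C: "C \<ge> 1"
    and \<theta>0: "\<theta> 0 = \<tau> ^ J / (2 * real R)" and \<theta>_Suc: "\<And>j. \<theta> (Suc j) = \<xi> * \<theta> j ^ 6 / C"
    and large: "C < real (card V) * \<theta> J ^ 4"
    and f: "decorrelated J C (\<lambda>x. of_bool (x \<in> H) - 1 / real R)"
  shows "\<exists>good. translation_game V H \<tau> \<xi> good \<and> good J V V"
proof -
  define f where "f x = of_bool (x \<in> H) - 1 / real R" for x
  have f: "decorrelated J C f" using f by (simp add: f_def[abs_def])
  have \<theta>: "0 < \<theta> j \<and> \<theta> j \<le> 1" for j
  proof (induction j)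
    case 0
    have "\<tau> ^ J \<le> 1" "1 \<le> 2 * real R" using \<tau> R by (auto intro: power_le_one)
    then show ?case using \<tau> R by (simp add: \<theta>0 divide_simps)
  next
    case (Suc j)
    have "\<xi> * \<theta> j ^ 6 \<le> 1 * 1" using Suc \<xi> by (intro mult_mono power_le_one) auto
    then show ?case using Suc \<xi> C by (simp add: \<theta>_Suc divide_simps)
  qed
  have \<theta>_Suc_le: "\<theta> (Suc j) \<le> (\<theta> j)\<^sup>2" for j
  proof -
    have "\<xi> * \<theta> j ^ 6 \<le> 1 * \<theta> j ^ 2" using \<theta>[of j] \<xi> by (intro mult_mono power_decreasing) auto
    also have "\<dots> \<le> \<theta> j ^ 2 * C" using mult_left_mono[OF C, of "\<theta> j ^ 2"] by simp
    finally show ?thesis using C by (simp add: \<theta>_Suc divide_simps)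
  qed
  have corr_gt_Suc: "\<theta> (Suc j) < corr (Suc j) F" if "\<theta> j < corr j F" for j F
  proof -
    have "(\<theta> j)\<^sup>2 < (corr j F)\<^sup>2" using that \<theta>[of j] by (intro power_strict_mono) auto
    then show ?thesis using \<theta>_Suc_le[of j] corr_square_le_Suc[of j F] by linarith
  qed
  define u where "u A w x = of_bool (x \<in> A) * f (x + w)" for A w x
  define good where "good j A B \<longleftrightarrow> A \<subseteq> V \<and> B \<subseteq> V \<and> j \<le> J \<and>
    \<tau> ^ (J - j) * real (card V) \<le> real (card A) \<and> \<tau> ^ (J - j) * real (card V) \<le> real (card B) \<and>
    (\<forall>w\<in>V. corr j (u A w) \<le> \<theta> j \<or> corr j (u B w) \<le> \<theta> j)" for j A B
  have hit: "\<exists>x\<in>A. x + w \<in> H"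
    if A: "A \<subseteq> V" "\<tau> ^ (J - j) * real (card V) \<le> real (card A)" and w: "w \<in> V" "corr j (u A w) \<le> \<theta> j" for A j w
  proof (rule ccontr)
    assume no: "\<not> (\<exists>x\<in>A. x + w \<in> H)"
    \<comment> \<open>If A misses the translate of H, the deviation equals -1/R throughout A. This
      gives a level 0 correlation of at least \<tau>^J / R, twice \<open>\<theta> 0\<close>, and
      squaring carries it to every level, against smallness at level j.\<close>
    have "\<theta> i < corr i (u A w)" for i
    proof (induction i)
      case 0
      have "u A w = (\<lambda>x. of_bool (x \<in> A) * (- 1 / real R))"
        using no by (auto simp: u_def f_def fun_eq_iff)
      then have "avg (u A w) = real (card A) / real (card V) * (- 1 / real R)"
        using A(1) by (simp only: avg_multc avg_indicator)
      then have "corr 0 (u A w) = real (card A) / real (card V) / real R"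
        by (simp add: abs_mult)
      moreover have "\<tau> ^ J \<le> \<tau> ^ (J - j)" using \<tau> by (intro power_decreasing) auto
      moreover have "\<tau> ^ (J - j) \<le> real (card A) / real (card V)" using A(2) by (simp add: pos_le_divide_eq)
      ultimately have "\<tau> ^ J / real R \<le> corr 0 (u A w)"
        by (metis divide_right_mono of_nat_0_le_iff order_trans)
      moreover have "\<theta> 0 < \<tau> ^ J / real R" using \<tau> R by (simp add: \<theta>0 divide_simps)
      ultimately show ?case by linarith
    qed (rule corr_gt_Suc)
    then show False using w(2) by (meson not_le)
  qed
  have "translation_game V H \<tau> \<xi> good"
    unfolding translation_game_def
  proof (intro conjI allI impI)
    fix j A B assume g: "good j A B"
    show "A \<subseteq> V" "good j B A" using g by (auto simp: good_def)
    have "0 < \<tau> ^ (J - j) * real (card V)" using \<tau> by simp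
    also have "\<dots> \<le> real (card A)" using g by (simp add: good_def)
    finally show "A \<noteq> {}" by auto
    show "\<forall>w\<in>V. (\<exists>x\<in>A. x + w \<in> H) \<or> (\<exists>x\<in>B. x + w \<in> H)"
      using g hit[of A j] hit[of B j] unfolding good_def by meson
  next
    fix j A B D assume g: "good (Suc j) A B"
    let ?A' = "\<lambda>z. {x \<in> A. x + z \<in> D}"
    define W where "W = {w \<in> V. \<theta> j < corr j (u B w)}"
    define Z where "Z w = {z \<in> V. (\<theta> j)\<^sup>2 < (corr j (\<lambda>x. u A w x * of_bool (x + z \<in> D)))\<^sup>2}" for w
    have j: "Suc j \<le> J" using g by (simp add: good_def)
    have \<tau>j: "\<tau> ^ (J - j) = \<tau> * \<tau> ^ (J - Suc j)"
      using j by (metis Suc_diff_Suc Suc_le_lessD power_Suc)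
    have W: "real (card W) * \<theta> j ^ 4 \<le> C"
      by (rule card_correlated_shifts_le[OF f, of j "\<lambda>x. of_bool (x \<in> B)"])
        (use j \<theta>[of j] in \<open>auto simp: W_def u_def[abs_def]\<close>)
    have Z: "real (card (Z w)) * (\<theta> j)\<^sup>2 \<le> real (card V) * \<theta> (Suc j)" if w: "w \<in> W" for w
    proof -
      \<comment> \<open>A w that is bad for B at level j is also bad for B at level Suc j, so by
        goodness of the pair it is not bad for A there.\<close>
      have "corr (Suc j) (u A w) \<le> \<theta> (Suc j)"
        using g w corr_gt_Suc[of j "u B w"] unfolding good_def W_def by force
      moreover have "avg (\<lambda>z. (corr j (\<lambda>x. u A w x * of_bool (x + z \<in> D)))\<^sup>2) \<le> corr (Suc j) (u A w)"
        by (rule avg_corr_mult_shift_le[where d = "\<lambda>y. of_bool (y \<in> D)"]) simp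
      moreover have "real (card (Z w)) * (\<theta> j)\<^sup>2
          \<le> real (card V) * avg (\<lambda>z. (corr j (\<lambda>x. u A w x * of_bool (x + z \<in> D)))\<^sup>2)"
        unfolding Z_def by (rule card_gt_mult_le) auto
      ultimately show ?thesis
        by (meson mult_left_mono of_nat_0_le_iff order_trans)
    qed
    have "{z \<in> V. \<tau> * real (card A) \<le> real (card (?A' z)) \<and> \<not> good j (?A' z) B} \<subseteq> (\<Union>w\<in>W. Z w)"
    proof
      fix z assume "z \<in> {z \<in> V. \<tau> * real (card A) \<le> real (card (?A' z)) \<and> \<not> good j (?A' z) B}"
      then have z: "z \<in> V" "\<tau> * real (card A) \<le> real (card (?A' z))" "\<not> good j (?A' z) B" by auto
      have "\<tau> * (\<tau> ^ (J - Suc j) * real (card V)) \<le> \<tau> * real (card A)"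
        using g \<tau> by (intro mult_left_mono) (auto simp: good_def)
      then have 1: "\<tau> ^ (J - j) * real (card V) \<le> real (card (?A' z))"
        using z(2) unfolding \<tau>j by linarith
      have "\<tau> ^ (J - j) * real (card V) \<le> \<tau> ^ (J - Suc j) * real (card V)"
        using \<tau> by (intro mult_right_mono power_decreasing) auto
      then have 2: "\<tau> ^ (J - j) * real (card V) \<le> real (card B)"
        using g unfolding good_def by (meson order_trans)
      have "?A' z \<subseteq> V" "B \<subseteq> V" using g by (auto simp: good_def)
      with z(3) 1 2 j obtain w where w: "w \<in> V" "\<theta> j < corr j (u (?A' z) w)" "\<theta> j < corr j (u B w)"
        unfolding good_def by (auto simp: not_le)
      have "u (?A' z) w = (\<lambda>x. u A w x * of_bool (x + z \<in> D))"
        by (auto simp: u_def)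
      then have "z \<in> Z w" using z(1) w(2) \<theta>[of j] unfolding Z_def
        by (auto intro!: power_strict_mono)
      then show "z \<in> (\<Union>w\<in>W. Z w)" using w by (auto simp: W_def)
    qed
    then have "real (card {z \<in> V. \<tau> * real (card A) \<le> real (card (?A' z)) \<and> \<not> good j (?A' z) B})
        \<le> real (card (\<Union>w\<in>W. Z w))"
      by (intro of_nat_mono card_mono) (auto simp: W_def Z_def)
    also have "\<dots> \<le> real (\<Sum>w\<in>W. card (Z w))"
      by (intro of_nat_mono card_UN_le) (auto simp: W_def)
    also have "\<dots> = (\<Sum>w\<in>W. real (card (Z w)))" by simp
    also have "\<dots> \<le> (\<Sum>w\<in>W. real (card V) * \<theta> (Suc j) / (\<theta> j)\<^sup>2)"
      using Z \<theta>[of j] by (intro sum_mono) (simp add: pos_le_divide_eq)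
    also have "\<dots> = (real (card W) * \<theta> j ^ 4) * (real (card V) * \<xi> / C)"
    proof -
      have "\<theta> (Suc j) / (\<theta> j)\<^sup>2 = \<xi> * \<theta> j ^ 4 / C"
        using \<theta>[of j] by (simp add: \<theta>_Suc eval_nat_numeral)
      then have "real (card W) * (real (card V) * (\<theta> (Suc j) / (\<theta> j)\<^sup>2))
          = real (card W) * (real (card V) * (\<xi> * \<theta> j ^ 4 / C))" by (simp only:)
      then show ?thesis by (simp add: ac_simps)
    qed
    also have "\<dots> \<le> C * (real (card V) * \<xi> / C)"
      using W C \<xi> by (intro mult_right_mono) auto
    also have "\<dots> = \<xi> * real (card V)" using C by simp
    finally show "real (card {z \<in> V. \<tau> * real (card A) \<le> real (card (?A' z)) \<and> \<not> good j (?A' z) B})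
      \<le> \<xi> * real (card V)" .
  qed
  moreover have "good J V V"
  proof -
    have eq: "corr J (u V w) = corr J f" if "w \<in> V" for w
      using corr_cong[of "u V w" "\<lambda>x. f (x + w)" J] corr_shift[OF that, of J f] by (simp add: u_def)
    \<comment> \<open>The correlation of V with a translate is the same for all w. If it were too
      large, all of V would be bad, more than C / \<theta>_J^4 elements.\<close>
    have "corr J f \<le> \<theta> J"
    proof (rule ccontr)
      assume "\<not> corr J f \<le> \<theta> J"
      then have "real (card V) * \<theta> J ^ 4 \<le> C"
        using \<theta>[of J] corr_shift[of _ J f]
        by (intro card_correlated_shifts_le[OF f, of J "\<lambda>_. 1"]) auto
      then show False using large by simp
    qed
    then show ?thesis by (auto simp: good_def eq)
  qed
  ultimately show ?thesis by blast
qed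

end

text \<open>The quantifier order matters: m depends on the parameters alone, so a block can be made
  long enough after its game has been specified.\<close>

lemma exists_translation_game:
  fixes R J :: nat and \<tau> \<xi> :: real
  assumes R: "R \<ge> 1" and \<tau>: "0 < \<tau>" "\<tau> \<le> 1" and \<xi>: "0 < \<xi>" "\<xi> \<le> 1"
  shows "\<exists>m. \<forall>V::'a::ab_group_add set. finite_boolean_group V \<longrightarrow> m \<le> card V \<longrightarrow>
    (\<exists>H good. H \<subseteq> V \<and> real (card H) * real R \<le> 2 * real (card V) \<and>
      translation_game V H \<tau> \<xi> good \<and> good J V V)"
proof -
  define C :: real where "C = real (Suc J) * 2 ^ (J + 4)"
  define \<theta> where "\<theta> = rec_nat (\<tau> ^ J / (2 * real R)) (\<lambda>_ t. \<xi> * t ^ 6 / C)"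
  have "1 * 1 \<le> real (Suc J) * 2 ^ (J + 4)" by (intro mult_mono one_le_power) auto
  then have C: "C \<ge> 1" by (simp add: C_def)
  have \<theta>: "\<theta> 0 = \<tau> ^ J / (2 * real R)" "\<And>j. \<theta> (Suc j) = \<xi> * \<theta> j ^ 6 / C"
    by (simp_all add: \<theta>_def)
  have pos: "\<theta> j > 0" for j
    by (induction j) (use \<tau> R \<xi> C in \<open>auto simp: \<theta>\<close>)
  obtain m :: nat where m: "C / \<theta> J ^ 4 < real m" using reals_Archimedean2 by blast
  have "\<exists>H good. H \<subseteq> V \<and> real (card H) * real R \<le> 2 * real (card V) \<and>
      translation_game V H \<tau> \<xi> good \<and> good J V V"
    if V: "finite_boolean_group V" "m \<le> card V" for V :: "'a set"
  proof -
    interpret finite_boolean_group V by (rule V(1))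
    obtain H where H: "H \<subseteq> V" "real (card H) * real R \<le> 2 * real (card V)"
      "decorrelated J C (\<lambda>x. of_bool (x \<in> H) - 1 / real R)"
      using exists_decorrelated_set[OF R, of J] unfolding C_def by blast
    have "C / \<theta> J ^ 4 < real (card V)" using m V(2) by linarith
    then have "C < real (card V) * \<theta> J ^ 4" using pos[of J] by (simp add: pos_divide_less_eq)
    then show ?thesis using exists_good_relation[OF R \<tau> \<xi> C \<theta> _ H(3)] H(1,2) by blast
  qed
  then show ?thesis by blast
qed

section \<open>Blocks of the Cantor space\<close>

lemma bit_fun_add_self [simp]: "(x :: 'a \<Rightarrow> bit) + x = 0"
proof
  fix i
  show "(x + x) i = 0 i" by (cases "x i = 0") simp_all
qed

lemma bit_fun_add_cancel [simp]: "(x :: 'a \<Rightarrow> bit) + (x + y) = y"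
  by (metis add.assoc add_0 bit_fun_add_self)

lemma bit_fun_add_cancel_right [simp]: "(y :: 'a \<Rightarrow> bit) + x + x = y"
  by (simp add: add.assoc)

text \<open>Finite words are full sequences that vanish outside a window, so concatenation of words
  is addition and all blocks live in one group.\<close>

definition seg :: "nat \<Rightarrow> nat \<Rightarrow> cantor set" where
  "seg a b = {x. \<forall>i. i \<notin> {a..<b} \<longrightarrow> x i = 0}"

definition proj :: "nat \<Rightarrow> nat \<Rightarrow> cantor \<Rightarrow> cantor" where
  "proj a b x = (\<lambda>i. if i \<in> {a..<b} then x i else 0)"

lemma proj_in_seg [simp]: "proj a b x \<in> seg a b"
  by (simp add: proj_def seg_def)

lemma proj_add: "proj a b (x + y) = proj a b x + proj a b y"
  by (simp add: proj_def fun_eq_iff)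

lemma proj_seg: "x \<in> seg a b \<Longrightarrow> proj a b x = x"
  by (auto simp: proj_def seg_def fun_eq_iff)

lemma proj_seg_disjoint: "x \<in> seg a b \<Longrightarrow> d \<le> a \<or> b \<le> c \<Longrightarrow> proj c d x = 0"
  by (auto simp: proj_def seg_def fun_eq_iff)

lemma proj_proj_initial: "b \<le> c \<Longrightarrow> proj 0 b (proj 0 c x) = proj 0 b x"
  by (auto simp: proj_def fun_eq_iff)

lemma proj_split: "a \<le> b \<Longrightarrow> proj 0 b x = proj 0 a x + proj a b x"
  by (auto simp: proj_def fun_eq_iff)

lemma UNIV_bit: "(UNIV :: bit set) = {0, 1}"
  by (auto simp flip: bit_not_zero_iff)

lemma card_seg: "card (seg a b) = 2 ^ (b - a)"
proof -
  have "bij_betw (\<lambda>x. restrict x {a..<b}) (seg a b) ({a..<b} \<rightarrow>\<^sub>E (UNIV :: bit set))"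
  proof (rule bij_betwI[where g = "\<lambda>f i. if i \<in> {a..<b} then f i else 0"])
    show "(\<lambda>i. if i \<in> {a..<b} then restrict x {a..<b} i else 0) = x" if "x \<in> seg a b" for x
      using that by (auto simp: seg_def fun_eq_iff)
    show "restrict (\<lambda>i. if i \<in> {a..<b} then f i else 0) {a..<b} = f"
      if "f \<in> {a..<b} \<rightarrow>\<^sub>E (UNIV :: bit set)" for f
      using that by (auto simp: PiE_iff extensional_def fun_eq_iff)
  qed (auto simp: seg_def)
  then have "card (seg a b) = card ({a..<b} \<rightarrow>\<^sub>E (UNIV :: bit set))"
    by (rule bij_betw_same_card)
  also have "\<dots> = 2 ^ (b - a)" by (simp add: card_PiE UNIV_bit numeral_2_eq_2)
  finally show ?thesis .
qed

lemma finite_seg [simp]: "finite (seg a b)"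
  using card_seg[of a b] by (intro card_ge_0_finite) simp

lemma finite_boolean_group_seg: "finite_boolean_group (seg a b)"
proof
  show "finite (seg a b)" by simp
qed (auto simp: seg_def)

text \<open>
  The factor \<open>2 ^ (2 ^ n)\<close> counts the sets of initial segments of length \<open>n\<close>. Block values are sorted
  by the set of initial segments that they make fatal; as the number of these types is fixed
  before the length of block \<open>k\<close> is chosen, a popular type exists and a union bound over all types is affordable.
\<close>

definition shrink :: "nat \<Rightarrow> nat \<Rightarrow> real" where
  "shrink k n = (1/2) ^ k / 2 ^ (2 ^ n)"

text \<open>Level k at block k makes the number of available moves tend to infinity along the
  blocks. The density 2^-k of \<open>H k\<close> is summable. The density threshold is half of
  \<open>shrink\<close> because \<open>popular_type\<close> loses a factor 2.\<close>

locale block_system =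
  fixes N :: "nat \<Rightarrow> nat" and H :: "nat \<Rightarrow> cantor set"
    and good :: "nat \<Rightarrow> nat \<Rightarrow> cantor set \<Rightarrow> cantor set \<Rightarrow> bool"
  assumes N_0: "N 0 = 0" and strict_mono_N: "strict_mono N"
    and H_seg: "H k \<subseteq> seg (N k) (N (Suc k))"
    and card_H: "real (card (H k)) * 2 ^ k \<le> real (card (seg (N k) (N (Suc k))))"
    and game: "translation_game (seg (N k) (N (Suc k))) (H k)
      (shrink k (N k) / 2) (shrink k (N k)) (good k)"
    and good_start: "good k k (seg (N k) (N (Suc k))) (seg (N k) (N (Suc k)))"

text \<open>\<open>N k\<close> fixes the number of types, hence the game parameters, hence a lower
  bound on the size of block k. The value R = 2^(k+1) absorbs the factor 2 in the size of the random
  set.\<close>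

lemma exists_block_system: "\<exists>N H good. block_system N H good"
proof -
  have "\<forall>k n. \<exists>m. \<forall>V::cantor set. finite_boolean_group V \<longrightarrow> m \<le> card V \<longrightarrow>
      (\<exists>H good. H \<subseteq> V \<and> real (card H) * real (2 ^ Suc k) \<le> 2 * real (card V) \<and>
        translation_game V H (shrink k n / 2) (shrink k n) good \<and> good k V V)"
  proof (intro allI)
    fix k n :: nat
    have "shrink k n \<le> 1"
    proof -
      have "(1/2::real) ^ k \<le> 1" "(1::real) \<le> 2 ^ (2 ^ n)" by (auto intro: power_le_one)
      then show ?thesis unfolding shrink_def by (subst divide_le_eq_1_pos) linarith+
    qed
    moreover have "shrink k n > 0" by (simp add: shrink_def)
    ultimately show "\<exists>m. \<forall>V::cantor set. finite_boolean_group V \<longrightarrow> m \<le> card V \<longrightarrow>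
      (\<exists>H good. H \<subseteq> V \<and> real (card H) * real (2 ^ Suc k) \<le> 2 * real (card V) \<and>
        translation_game V H (shrink k n / 2) (shrink k n) good \<and> good k V V)"
      by (intro exists_translation_game) auto
  qed
  then obtain m where m: "\<And>k n V. finite_boolean_group (V::cantor set) \<Longrightarrow> m k n \<le> card V \<Longrightarrow>
      (\<exists>H good. H \<subseteq> V \<and> real (card H) * real (2 ^ Suc k) \<le> 2 * real (card V) \<and>
        translation_game V H (shrink k n / 2) (shrink k n) good \<and> good k V V)"
    by metis
  define N where "N = rec_nat 0 (\<lambda>k n. n + Suc (m k n))"
  have N: "N 0 = 0" "\<And>k. N (Suc k) = N k + Suc (m k (N k))" by (simp_all add: N_def)
  have "\<exists>H good. H \<subseteq> seg (N k) (N (Suc k)) \<and>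
      real (card H) * real (2 ^ Suc k) \<le> 2 * real (card (seg (N k) (N (Suc k)))) \<and>
      translation_game (seg (N k) (N (Suc k))) H (shrink k (N k) / 2) (shrink k (N k)) good \<and>
      good k (seg (N k) (N (Suc k))) (seg (N k) (N (Suc k)))" for k
  proof (rule m[OF finite_boolean_group_seg])
    have "m k (N k) < 2 ^ m k (N k)" by (rule less_exp)
    also have "\<dots> \<le> card (seg (N k) (N (Suc k)))" by (simp add: card_seg N(2))
    finally show "m k (N k) \<le> card (seg (N k) (N (Suc k)))" by simp
  qed
  then obtain H good where "\<And>k. H k \<subseteq> seg (N k) (N (Suc k)) \<and>
      real (card (H k)) * real (2 ^ Suc k) \<le> 2 * real (card (seg (N k) (N (Suc k)))) \<and>
      translation_game (seg (N k) (N (Suc k))) (H k) (shrink k (N k) / 2) (shrink k (N k)) (good k) \<and>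
      good k k (seg (N k) (N (Suc k))) (seg (N k) (N (Suc k)))"
    by metis
  then have "block_system N H good"
    by unfold_locales (auto simp: N strict_mono_Suc_iff)
  then show ?thesis by blast
qed

text \<open>By Markov's inequality at least a fraction \<epsilon>/2 of the y have a set whose
  density exceeds the mean by at most \<epsilon>. The pigeonhole principle over the 2^|Q| possible
  sets then gives T.\<close>

lemma popular_type:
  fixes s :: "'a \<Rightarrow> 'b set" and \<epsilon> :: real
  assumes A: "finite A" "A \<noteq> {}" and Q: "finite Q" "Q \<noteq> {}" and s: "\<And>y. y \<in> A \<Longrightarrow> s y \<subseteq> Q"
    and \<epsilon>: "0 < \<epsilon>" "\<epsilon> \<le> 1"
  shows "\<exists>T\<subseteq>Q. real (card T) / real (card Q)
      \<le> (\<Sum>y\<in>A. real (card (s y)) / real (card Q)) / real (card A) + \<epsilon> \<and>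
    \<epsilon> / (2 * 2 ^ card Q) * real (card A) \<le> real (card {y \<in> A. s y = T})"
proof -
  define f where "f y = real (card (s y)) / real (card Q)" for y
  define m where "m = (\<Sum>y\<in>A. f y) / real (card A)"
  define G where "G = {y \<in> A. f y \<le> m + \<epsilon>}"
  have cA: "0 < real (card A)" using A by (simp add: card_gt_0_iff)
  have cQ: "0 < real (card Q)" using Q by (simp add: card_gt_0_iff)
  have f: "0 \<le> f y" "y \<in> A \<Longrightarrow> f y \<le> 1" for y
    using cQ s[of y] Q(1) by (auto simp: f_def divide_simps card_mono)
  have m: "0 \<le> m" "m \<le> 1" "m * real (card A) = (\<Sum>y\<in>A. f y)"
    using sum_nonneg[of A f] f sum_bounded_above[of A f 1] cA by (auto simp: m_def divide_simps)
  have "(\<Sum>y\<in>A - G. m + \<epsilon>) \<le> (\<Sum>y\<in>A - G. f y)"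
    by (intro sum_mono) (auto simp: G_def)
  also have "\<dots> \<le> (\<Sum>y\<in>A. f y)"
    using A f by (intro sum_mono2) auto
  finally have "real (card (A - G)) * (m + \<epsilon>) \<le> m * real (card A)" using m by simp
  moreover have cAG: "real (card A) = real (card G) + real (card (A - G))"
    using A card_Un_disjoint[of G "A - G"] by (auto simp: G_def Un_absorb1 simp flip: of_nat_add)
  ultimately have "\<epsilon> * real (card A) \<le> real (card G) * (m + \<epsilon>)" by (simp add: algebra_simps)
  also have "\<dots> \<le> real (card G) * 2" using m \<epsilon> by (intro mult_left_mono) auto
  finally have cG: "\<epsilon> * real (card A) \<le> real (card G) * 2" .
  have "0 < \<epsilon> * real (card A)" using \<epsilon> cA by simp
  with cG have "G \<noteq> {}" by auto
  have finG: "finite G" using A by (simp add: G_def)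
  have "\<exists>T\<in>s ` G. real (card G) / 2 ^ card Q \<le> real (card {y \<in> G. s y = T})"
  proof (rule ccontr)
    assume "\<not> ?thesis"
    then have less: "\<And>T. T \<in> s ` G \<Longrightarrow> real (card {y \<in> G. s y = T}) < real (card G) / 2 ^ card Q"
      by (auto simp: not_le)
    have "s ` G \<subseteq> Pow Q" using s by (auto simp: G_def)
    then have "card (s ` G) \<le> 2 ^ card Q"
      using card_mono[of "Pow Q" "s ` G"] Q by (simp add: card_Pow)
    then have le: "real (card (s ` G)) \<le> 2 ^ card Q" by (metis of_nat_le_iff of_nat_numeral of_nat_power)
    have "G = (\<Union>T\<in>s ` G. {y \<in> G. s y = T})" by auto
    then have "real (card G) \<le> (\<Sum>T\<in>s ` G. real (card {y \<in> G. s y = T}))"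
      using card_UN_le[of "s ` G" "\<lambda>T. {y \<in> G. s y = T}"] finG by (simp flip: of_nat_sum)
    also have "\<dots> < (\<Sum>T\<in>s ` G. real (card G) / 2 ^ card Q)"
      using finG \<open>G \<noteq> {}\<close> less by (intro sum_strict_mono) auto
    also have "\<dots> \<le> real (card G)"
      using mult_right_mono[OF le, of "real (card G)"] by (simp add: pos_divide_le_eq mult.commute)
    finally show False by simp
  qed
  then obtain y0 where y0: "y0 \<in> G" "real (card G) / 2 ^ card Q \<le> real (card {y \<in> G. s y = s y0})"
    by blast
  have "\<epsilon> / (2 * 2 ^ card Q) * real (card A) \<le> real (card G) / 2 ^ card Q"
    using cG by (simp add: divide_simps)
  also have "\<dots> \<le> real (card {y \<in> A. s y = s y0})"
    using y0(2) A card_mono[of "{y \<in> A. s y = s y0}" "{y \<in> G. s y = s y0}"] by (force simp: G_def)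
  finally have "\<epsilon> / (2 * 2 ^ card Q) * real (card A) \<le> real (card {y \<in> A. s y = s y0})" .
  moreover have "f y0 \<le> m + \<epsilon>" "s y0 \<subseteq> Q" using y0 s by (auto simp: G_def)
  ultimately show ?thesis unfolding f_def m_def by blast
qed

section \<open>Counting the translations that escape finitely many levels of forbidden words\<close>

context block_system
begin

abbreviation V :: "nat \<Rightarrow> cantor set" where "V k \<equiv> seg (N k) (N (Suc k))"
abbreviation P :: "nat \<Rightarrow> cantor set" where "P k \<equiv> seg 0 (N k)"
abbreviation blk :: "nat \<Rightarrow> cantor \<Rightarrow> cantor" where "blk k \<equiv> proj (N k) (N (Suc k))"
abbreviation trunc :: "nat \<Rightarrow> cantor \<Rightarrow> cantor" where "trunc k \<equiv> proj 0 (N k)"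

lemma N_mono: "i \<le> j \<Longrightarrow> N i \<le> N j"
  using strict_mono_N by (simp add: strict_mono_less_eq)

lemmas good_rule = conjunct1[OF game[unfolded translation_game_def], rule_format]
lemmas good_step = conjunct2[OF game[unfolded translation_game_def], rule_format]

lemma goodD:
  assumes "good k j A B"
  shows "A \<noteq> {}" "A \<subseteq> V k" "good k j B A" "finite A"
  using good_rule[OF assms] finite_subset[OF _ finite_seg] by auto

lemma good_hit: "good k j A B \<Longrightarrow> w \<in> V k \<Longrightarrow> (\<exists>x\<in>A. x + w \<in> H k) \<or> (\<exists>x\<in>B. x + w \<in> H k)"
  using good_rule by simp

lemma card_P_Suc: "card (P (Suc k)) = card (P k) * card (V k)"
  using N_mono[of k "Suc k"] by (simp add: card_seg flip: power_add)

lemma card_P_pos [simp]: "0 < card (P k)" by (simp add: card_seg)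

lemma trunc_add_block: "k \<le> K \<Longrightarrow> v \<in> V K \<Longrightarrow> trunc k (x + v) = trunc k x"
  using proj_seg_disjoint[of v "N K" "N (Suc K)" "N k" 0] N_mono[of k K] by (simp add: proj_add)

lemma trunc_Suc: "trunc (Suc k) x = trunc k x + blk k x"
  by (rule proj_split) (simp add: N_mono)

text \<open>\<open>F k\<close> is a set of forbidden words on the first k blocks. Level k sees only
  the blocks below k, so level k0 constrains the stem \<open>\<sigma>\<close> alone.\<close>

definition avoids ::
  "nat \<Rightarrow> nat \<Rightarrow> (nat \<Rightarrow> cantor set) \<Rightarrow> cantor \<Rightarrow> cantor \<Rightarrow> (nat \<Rightarrow> cantor set) \<Rightarrow> bool" where
  "avoids k0 K F z \<sigma> A \<longleftrightarrow> (\<forall>k\<in>{k0..K}. \<forall>x. trunc k0 x = \<sigma> \<and> (\<forall>i\<in>{k0..<k}. blk i x \<in> A i) \<longrightarrow>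
    trunc k (x + z) \<notin> F k)"

definition escapable ::
  "nat \<Rightarrow> (nat \<Rightarrow> nat) \<Rightarrow> (nat \<Rightarrow> cantor set) \<Rightarrow> (nat \<Rightarrow> cantor set) \<Rightarrow> nat \<Rightarrow> (nat \<Rightarrow> cantor set) \<Rightarrow> cantor \<Rightarrow> bool" where
  "escapable k0 l A B K F z \<longleftrightarrow> (\<exists>\<sigma>\<in>P k0. \<exists>A'. (\<forall>k\<in>{k0..<K}. A' k \<subseteq> A k \<and> good k (l k) (A' k) (B k)) \<and>
    avoids k0 K F z \<sigma> A')"

lemma escapable_base:
  assumes F: "F k0 \<subseteq> P k0" "F k0 \<noteq> P k0" and z: "z \<in> P k0"
  shows "escapable k0 l A B k0 F z"
proof -
  obtain p where p: "p \<in> P k0" "p \<notin> F k0" using F by blast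
  interpret finite_boolean_group "P k0" by (rule finite_boolean_group_seg)
  have "avoids k0 k0 F z (p + z) A"
    using p z by (auto simp: avoids_def proj_add proj_seg)
  then show ?thesis using p z unfolding escapable_def by (intro bexI[of _ "p + z"] exI[of _ A]) auto
qed

definition fatal :: "cantor set \<Rightarrow> nat \<Rightarrow> cantor \<Rightarrow> cantor set" where
  "fatal E K y = {\<sigma> \<in> P K. \<sigma> + y \<in> E}"

text \<open>If all values left in block K, after translation by v, have the same fatal set T, then
  the words forbidden at level Suc K are avoided as soon as T is avoided at level K. The constraint
  moves down one level and joins \<open>F K\<close>.\<close>

lemma escapable_Suc:
  assumes K: "k0 \<le> K" and v: "v \<in> V K" and zP: "z \<in> P K" and z: "escapable k0 l A B K (F(K := F K \<union> T)) z"
    and g: "good K (l K) {x \<in> A K. x + v \<in> {y \<in> V K. fatal (F (Suc K)) K y = T}} (B K)"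
  shows "escapable k0 l A B (Suc K) F (z + v)"
proof -
  define A1 where "A1 = {x \<in> A K. x + v \<in> {y \<in> V K. fatal (F (Suc K)) K y = T}}"
  obtain \<sigma> A' where \<sigma>: "\<sigma> \<in> P k0" and A': "\<forall>k\<in>{k0..<K}. A' k \<subseteq> A k \<and> good k (l k) (A' k) (B k)"
    and av: "avoids k0 K (F(K := F K \<union> T)) z \<sigma> A'"
    using z unfolding escapable_def by blast
  have "avoids k0 (Suc K) F (z + v) \<sigma> (A'(K := A1))"
    unfolding avoids_def
  proof (intro ballI allI impI, elim conjE)
    fix k x assume k: "k \<in> {k0..Suc K}" and x: "trunc k0 x = \<sigma>"
      and blk: "\<forall>i\<in>{k0..<k}. blk i x \<in> (A'(K := A1)) i"
    have av': "trunc k (x + z) \<notin> (F(K := F K \<union> T)) k" if "k \<in> {k0..K}" "\<forall>i\<in>{k0..<k}. blk i x \<in> A' i" for k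
      using av x that unfolding avoids_def by blast
    show "trunc k (x + (z + v)) \<notin> F k"
    proof (cases "k \<le> K")
      case True
      have "\<forall>i\<in>{k0..<k}. blk i x \<in> A' i" using blk True by force
      moreover have "trunc k (x + (z + v)) = trunc k (x + z)"
        using trunc_add_block[OF True v, of "x + z"] by (simp add: add.assoc)
      ultimately show ?thesis using av'[of k] k True by (auto split: if_splits)
    next
      case False
      then have kK: "k = Suc K" using k by simp
      have "\<forall>i\<in>{k0..<K}. blk i x \<in> A' i" using blk kK by force
      then have 1: "trunc K (x + z) \<notin> T" using av'[of K] K by auto
      have "K \<in> {k0..<k}" using kK K by simp
      then have "blk K x \<in> A1" using blk by force
      then have 2: "fatal (F (Suc K)) K (blk K x + v) = T" by (simp add: A1_def)
      show ?thesis
      proof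
        assume "trunc k (x + (z + v)) \<in> F k"
        moreover have "blk K z = 0" using proj_seg_disjoint[OF zP] by simp
        then have "trunc (Suc K) (x + (z + v)) = trunc K (x + z) + (blk K x + v)"
          using trunc_add_block[OF order_refl v, of "x + z"] proj_seg[OF v]
          by (simp add: trunc_Suc proj_add ac_simps)
        ultimately have "trunc K (x + z) \<in> fatal (F (Suc K)) K (blk K x + v)"
          using kK by (simp add: fatal_def)
        then show False using 1 2 by simp
      qed
    qed
  qed
  moreover have "\<forall>k\<in>{k0..<Suc K}. (A'(K := A1)) k \<subseteq> A k \<and> good k (l k) ((A'(K := A1)) k) (B k)"
    using A' g by (auto simp: A1_def less_Suc_eq)
  ultimately show ?thesis using \<sigma> unfolding escapable_def by blast
qed

lemma sum_card_fatal_le: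
  assumes "E \<subseteq> P (Suc K)"
  shows "(\<Sum>v\<in>V K. card (fatal E K v)) \<le> card E"
proof -
  have "inj_on (\<lambda>(v, \<sigma>). \<sigma> + v) (SIGMA v:V K. fatal E K v)"
  proof (rule inj_on_inverseI[where g = "\<lambda>x. (blk K x, trunc K x)"])
    fix p assume "p \<in> (SIGMA v:V K. fatal E K v)"
    then obtain v \<sigma> where p: "p = (v, \<sigma>)" and *: "v \<in> V K" "\<sigma> \<in> P K" unfolding fatal_def by blast
    have "blk K \<sigma> = 0" using proj_seg_disjoint[OF *(2)] by simp
    moreover have "trunc K v = 0" using proj_seg_disjoint[OF *(1)] by simp
    ultimately show "(blk K (case p of (v, \<sigma>) \<Rightarrow> \<sigma> + v), trunc K (case p of (v, \<sigma>) \<Rightarrow> \<sigma> + v)) = p"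
      using * p by (simp add: proj_add proj_seg)
  qed
  moreover have "(\<lambda>(v, \<sigma>). \<sigma> + v) ` (SIGMA v:V K. fatal E K v) \<subseteq> E"
    by (auto simp: fatal_def)
  ultimately have "card (SIGMA v:V K. fatal E K v) \<le> card E"
    using finite_subset[OF assms finite_seg] by (metis card_image card_mono)
  moreover have "finite (fatal E K v)" for v unfolding fatal_def by simp
  ultimately show ?thesis by simp
qed

lemma card_not_escapable_Suc_le:
  "card {z \<in> P (Suc K). \<not> escapable k0 l A B (Suc K) F z}
    \<le> (\<Sum>v\<in>V K. card {z \<in> P K. \<not> escapable k0 l A B (Suc K) F (z + v)})"
proof -
  let ?Z = "\<lambda>v. {z \<in> P K. \<not> escapable k0 l A B (Suc K) F (z + v)}"
  have "{z \<in> P (Suc K). \<not> escapable k0 l A B (Suc K) F z} \<subseteq> (\<Union>v\<in>V K. (\<lambda>z. z + v) ` ?Z v)"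
  proof
    fix z assume z: "z \<in> {z \<in> P (Suc K). \<not> escapable k0 l A B (Suc K) F z}"
    then have "z = trunc K z + blk K z" using trunc_Suc[of K z] proj_seg[of z] by simp
    then show "z \<in> (\<Union>v\<in>V K. (\<lambda>z. z + v) ` ?Z v)"
      using z by (intro UN_I[of "blk K z"] image_eqI[of _ _ "trunc K z"]) auto
  qed
  then have "card {z \<in> P (Suc K). \<not> escapable k0 l A B (Suc K) F z} \<le> card (\<Union>v\<in>V K. (\<lambda>z. z + v) ` ?Z v)"
    by (intro card_mono finite_UN_I finite_imageI) auto
  also have "\<dots> \<le> (\<Sum>v\<in>V K. card ((\<lambda>z. z + v) ` ?Z v))" by (rule card_UN_le) simp
  also have "\<dots> \<le> (\<Sum>v\<in>V K. card (?Z v))" by (intro sum_mono card_image_le) simp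
  finally show ?thesis .
qed

definition dens :: "(nat \<Rightarrow> cantor set) \<Rightarrow> nat \<Rightarrow> real" where
  "dens F k = real (card (F k)) / real (card (P k))"

lemma dens_nonneg [simp]: "0 \<le> dens F k" by (simp add: dens_def)


text \<open>The popular T will depend on v, so all 2^(2^(N K)) sets T are excluded at once; the
  denominator of \<open>shrink\<close> pays for this union bound.\<close>

lemma card_unfit_le:
  assumes "good K (Suc j) A B"
  shows "real (card {v \<in> V K. \<exists>T\<in>Pow (P K). shrink K (N K) / 2 * real (card A) \<le> real (card {x \<in> A. x + v \<in> D T}) \<and>
      \<not> good K j {x \<in> A. x + v \<in> D T} B}) \<le> (1/2) ^ K * real (card (V K))"
proof -
  let ?U = "\<lambda>T. {v \<in> V K. shrink K (N K) / 2 * real (card A) \<le> real (card {x \<in> A. x + v \<in> D T}) \<and>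
      \<not> good K j {x \<in> A. x + v \<in> D T} B}"
  have "{v \<in> V K. \<exists>T\<in>Pow (P K). shrink K (N K) / 2 * real (card A) \<le> real (card {x \<in> A. x + v \<in> D T}) \<and>
      \<not> good K j {x \<in> A. x + v \<in> D T} B} = (\<Union>T\<in>Pow (P K). ?U T)" (is "?L = _") by blast
  moreover have "card (\<Union>T\<in>Pow (P K). ?U T) \<le> (\<Sum>T\<in>Pow (P K). card (?U T))"
    by (rule card_UN_le) simp
  ultimately have "real (card ?L) \<le> real (\<Sum>T\<in>Pow (P K). card (?U T))"
    by (simp only: of_nat_le_iff)
  also have "\<dots> = (\<Sum>T\<in>Pow (P K). real (card (?U T)))" by simp
  also have "\<dots> \<le> (\<Sum>T\<in>Pow (P K). shrink K (N K) * real (card (V K)))"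
    by (intro sum_mono good_step assms)
  also have "\<dots> = (1/2) ^ K * real (card (V K))"
    by (simp add: card_Pow card_seg shrink_def)
  finally show ?thesis .
qed

lemma exists_popular_fatal:
  assumes "good K (Suc j) A B"
  shows "\<exists>T\<subseteq>P K. real (card T) / real (card (P K))
      \<le> (\<Sum>y\<in>A. real (card (fatal E K (y + v))) / real (card (P K))) / real (card A) + (1/2) ^ K \<and>
    shrink K (N K) / 2 * real (card A) \<le> real (card {y \<in> A. fatal E K (y + v) = T})"
proof -
  have "P K \<noteq> {}" using card_P_pos[of K] by force
  moreover have "fatal E K (y + v) \<subseteq> P K" for y by (auto simp: fatal_def)
  moreover have "(1/2::real) ^ K / (2 * 2 ^ card (P K)) = shrink K (N K) / 2"
    by (simp add: shrink_def card_seg)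
  ultimately show ?thesis
    using popular_type[OF goodD(4,1)[OF assms] finite_seg, of 0 "N K" "\<lambda>y. fatal E K (y + v)" "(1/2) ^ K"]
    by (simp only: power_le_one zero_less_power) simp
qed

text \<open>For each fixed y the point y + v runs through all of \<open>V K\<close>, so after
  exchanging the sums the set A drops out.\<close>

lemma avg_fatal_le:
  assumes A: "A \<subseteq> V K" "finite A" "A \<noteq> {}" and E: "E \<subseteq> P (Suc K)"
  shows "(\<Sum>v\<in>V K. (\<Sum>y\<in>A. real (card (fatal E K (y + v))) / real (card (P K))) / real (card A))
    \<le> real (card E) / real (card (P K))"
proof -
  interpret finite_boolean_group "V K" by (rule finite_boolean_group_seg)
  define r where "r y = real (card (fatal E K y)) / real (card (P K))" for y
  have cA: "real (card A) > 0" using A by (simp add: card_gt_0_iff)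
  have "(\<Sum>v\<in>V K. (\<Sum>y\<in>A. r (y + v)) / real (card A)) = (\<Sum>y\<in>A. \<Sum>v\<in>V K. r (y + v)) / real (card A)"
    unfolding sum_divide_distrib[symmetric] by (subst sum.swap) (rule refl)
  also have "(\<Sum>y\<in>A. \<Sum>v\<in>V K. r (y + v)) = (\<Sum>y\<in>A. \<Sum>v\<in>V K. r v)"
    using A by (intro sum.cong refl sum.reindex_bij_betw[OF bij_betw_shift_left]) auto
  also have "\<dots> / real (card A) = (\<Sum>v\<in>V K. r v)" using cA by simp
  also have "\<dots> = real (\<Sum>v\<in>V K. card (fatal E K v)) / real (card (P K))"
    unfolding r_def of_nat_sum by (rule sum_divide_distrib[symmetric])
  also have "\<dots> \<le> real (card E) / real (card (P K))"
    by (intro divide_right_mono of_nat_mono sum_card_fatal_le E) simp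
  finally show ?thesis unfolding r_def .
qed

text \<open>The induction is over all F because the step enlarges \<open>F K\<close> by T. For a
  translation v of block K the set T costs the mean fatal density \<open>m v\<close> plus (1/2)^K;
  averaging \<open>m v\<close> over v gives back at most \<open>dens F (Suc K)\<close>. The unfit v
  cost another (1/2)^K, whence the factor 2.\<close>

lemma card_not_escapable_le:
  assumes "k0 \<le> K" "\<And>k. F k \<subseteq> P k" "\<And>k. k0 \<le> k \<Longrightarrow> k < K \<Longrightarrow> good k (Suc (l k)) (A k) (B k)"
  shows "real (card {z \<in> P K. \<not> escapable k0 l A B K F z}) \<le>
    real (card (P K)) * ((\<Sum>k\<in>{k0..K}. dens F k) + (\<Sum>k\<in>{k0..<K}. 2 * (1/2) ^ k))"
  using assms
proof (induction K arbitrary: F rule: dec_induct)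
  case base
  show ?case
  proof (cases "F k0 = P k0")
    case True
    have "card {z \<in> P k0. \<not> escapable k0 l A B k0 F z} \<le> card (P k0)"
      by (intro card_mono) auto
    then show ?thesis using True by (simp add: dens_def)
  next
    case False
    then have "{z \<in> P k0. \<not> escapable k0 l A B k0 F z} = {}"
      using escapable_base base by blast
    then have "card {z \<in> P k0. \<not> escapable k0 l A B k0 F z} = 0" by (simp only: card.empty)
    then show ?thesis by (simp only: of_nat_0) simp
  qed
next
  case (step K)
  let ?A = "A K" and ?p = "real (card (P K))" and ?E = "F (Suc K)" and ?\<epsilon> = "(1/2::real) ^ K"
  have g: "good K (Suc (l K)) ?A (B K)" using step.prems(2)[of K] step.hyps by simp
  define m where "m v = (\<Sum>y\<in>?A. real (card (fatal ?E K (y + v))) / ?p) / real (card ?A)" for v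
  define D where "D T = {y \<in> V K. fatal ?E K y = T}" for T
  define U where "U = {v \<in> V K. \<exists>T\<in>Pow (P K). shrink K (N K) / 2 * real (card ?A) \<le> real (card {x \<in> ?A. x + v \<in> D T}) \<and>
      \<not> good K (l K) {x \<in> ?A. x + v \<in> D T} (B K)}"
  define X where "X = (\<Sum>k\<in>{k0..K}. dens F k) + (\<Sum>k\<in>{k0..<K}. 2 * (1/2) ^ k)"
  define c where "c v = real (card {z \<in> P K. \<not> escapable k0 l A B (Suc K) F (z + v)})" for v
  have p: "?p > 0" by simp
  have X: "X \<ge> 0" unfolding X_def by (intro add_nonneg_nonneg sum_nonneg) auto
  have m: "m v \<ge> 0" for v unfolding m_def by (intro divide_nonneg_nonneg sum_nonneg) auto
  have c_le: "c v \<le> ?p * (X + m v + ?\<epsilon> + of_bool (v \<in> U))" if v: "v \<in> V K" for v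
  proof (cases "v \<in> U")
    case True
    have "card {z \<in> P K. \<not> escapable k0 l A B (Suc K) F (z + v)} \<le> card (P K)"
      by (intro card_mono) auto
    then have "c v \<le> ?p * 1" by (simp add: c_def)
    also have "\<dots> \<le> ?p * (X + m v + ?\<epsilon> + of_bool (v \<in> U))"
      using True X m[of v] by (intro mult_left_mono) auto
    finally show ?thesis .
  next
    case False
    obtain T where T: "T \<subseteq> P K" "real (card T) / ?p \<le> m v + ?\<epsilon>"
      "shrink K (N K) / 2 * real (card ?A) \<le> real (card {y \<in> ?A. fatal ?E K (y + v) = T})"
      using exists_popular_fatal[OF g, of ?E v] unfolding m_def by blast
    interpret finite_boolean_group "V K" by (rule finite_boolean_group_seg)
    have eq: "{x \<in> ?A. x + v \<in> D T} = {y \<in> ?A. fatal ?E K (y + v) = T}"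
      using goodD(2)[OF g] v by (auto simp: D_def)
    then have gT: "good K (l K) {x \<in> ?A. x + v \<in> D T} (B K)"
      using False v T(1,3)[folded eq] unfolding U_def by blast
    let ?F = "F(K := F K \<union> T)"
    have "c v \<le> real (card {z \<in> P K. \<not> escapable k0 l A B K ?F z})"
      unfolding c_def
    proof (intro of_nat_mono card_mono)
      show "{z \<in> P K. \<not> escapable k0 l A B (Suc K) F (z + v)} \<subseteq> {z \<in> P K. \<not> escapable k0 l A B K ?F z}"
        using escapable_Suc[where F = F and T = T, OF step.hyps(1) v] gT[unfolded D_def] by blast
    qed simp
    also have "\<dots> \<le> ?p * ((\<Sum>k\<in>{k0..K}. dens ?F k) + (\<Sum>k\<in>{k0..<K}. 2 * (1/2) ^ k))"
      by (rule step.IH) (use step.prems T(1) in auto)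
    also have "\<dots> \<le> ?p * (X + m v + ?\<epsilon>)"
    proof (rule mult_left_mono)
      have "dens ?F K \<le> dens F K + real (card T) / ?p"
        unfolding dens_def add_divide_distrib[symmetric]
        by (intro divide_right_mono) (auto simp flip: of_nat_add intro: card_Un_le)
      then have "dens ?F k \<le> dens F k + (if k = K then real (card T) / ?p else 0)" for k
        by (auto simp: dens_def)
      then have "(\<Sum>k\<in>{k0..K}. dens ?F k) \<le> (\<Sum>k\<in>{k0..K}. dens F k + (if k = K then real (card T) / ?p else 0))"
        by (intro sum_mono)
      also have "\<dots> = (\<Sum>k\<in>{k0..K}. dens F k) + real (card T) / ?p"
        using step.hyps by (simp add: sum.distrib sum.delta)
      finally show "(\<Sum>k\<in>{k0..K}. dens ?F k) + (\<Sum>k\<in>{k0..<K}. 2 * (1/2) ^ k) \<le> X + m v + ?\<epsilon>"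
        unfolding X_def using T(2) by linarith
    qed simp
    finally show ?thesis using False by simp
  qed
  have U: "real (card U) \<le> ?\<epsilon> * real (card (V K))"
    unfolding U_def by (rule card_unfit_le[OF g])
  have sum_m: "(\<Sum>v\<in>V K. m v) \<le> real (card ?E) / ?p"
    unfolding m_def using goodD[OF g] step.prems(1) by (intro avg_fatal_le)
  have U_sub: "U \<subseteq> V K" by (auto simp: U_def)
  have "real (card {z \<in> P (Suc K). \<not> escapable k0 l A B (Suc K) F z}) \<le> (\<Sum>v\<in>V K. c v)"
    unfolding c_def using card_not_escapable_Suc_le[of K k0 l A B F] by (simp flip: of_nat_sum)
  also have "\<dots> \<le> (\<Sum>v\<in>V K. ?p * (X + m v + ?\<epsilon> + of_bool (v \<in> U)))"
    by (intro sum_mono c_le)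
  also have "\<dots> = ?p * (real (card (V K)) * (X + ?\<epsilon>) + (\<Sum>v\<in>V K. m v) + (\<Sum>v\<in>V K. of_bool (v \<in> U)))"
    unfolding sum_distrib_left[symmetric] sum.distrib by (simp add: algebra_simps)
  also have "(\<Sum>v\<in>V K. of_bool (v \<in> U)) = real (card U)"
    using U_sub by (simp add: of_bool_def sum.If_cases Int_absorb1)
  also have "?p * (real (card (V K)) * (X + ?\<epsilon>) + (\<Sum>v\<in>V K. m v) + real (card U))
      \<le> ?p * (real (card (V K)) * (X + ?\<epsilon>) + real (card ?E) / ?p + ?\<epsilon> * real (card (V K)))"
    using sum_m U by (intro mult_left_mono) auto
  also have "\<dots> = real (card (P (Suc K))) * (X + dens F (Suc K) + 2 * ?\<epsilon>)"
  proof -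
    have "0 < real (card (V K))" by (simp add: card_seg)
    moreover have "?p * (v * (X + ?\<epsilon>) + e / ?p + ?\<epsilon> * v) = ?p * v * (X + e / (?p * v) + 2 * ?\<epsilon>)"
      if "0 < v" for v e :: real
      using p that by (simp add: field_simps del: card_gt_0_iff card_eq_0_iff card_P_pos)
    ultimately show ?thesis unfolding dens_def card_P_Suc of_nat_mult by blast
  qed
  also have "X + dens F (Suc K) + 2 * ?\<epsilon>
      = (\<Sum>k\<in>{k0..Suc K}. dens F k) + (\<Sum>k\<in>{k0..<Suc K}. 2 * (1/2) ^ k)"
    using step.hyps by (simp add: X_def)
  finally show ?case .
qed

end

section \<open>Null sets of the Cantor space\<close>

text \<open>The complete discrete metric makes the Cantor space Polish, which gives outer regularity
  of its measure.\<close>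

instantiation bit :: metric_space
begin

definition dist_bit :: "bit \<Rightarrow> bit \<Rightarrow> real" where
  "dist_bit x y = of_bool (x \<noteq> y)"

definition uniformity_bit :: "(bit \<times> bit) filter" where
  "uniformity_bit = (INF e\<in>{0<..}. principal {(x, y). dist x y < e})"

instance
proof
  show "uniformity = (INF e\<in>{0<..}. principal {(x :: bit, y). dist x y < e})"
    by (rule uniformity_bit_def)
  fix x y z :: bit
  show "(dist x y = 0) = (x = y)" by (simp add: dist_bit_def)
  show "dist x y \<le> dist x z + dist y z" by (simp add: dist_bit_def)
next
  fix U :: "bit set"
  have ev: "\<forall>\<^sub>F (x', y) in uniformity. x' = x \<longrightarrow> y = x" for x :: bit
  proof -
    have "{(x :: bit, y). dist x y < 1} = Id" by (auto simp: dist_bit_def)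
    moreover have "(uniformity :: (bit \<times> bit) filter) \<le> principal {(x, y). dist x y < 1}"
      unfolding uniformity_bit_def by (rule INF_lower) simp
    ultimately show ?thesis by (auto simp: le_principal elim: eventually_mono)
  qed
  then show "open U = (\<forall>x\<in>U. \<forall>\<^sub>F (x', y) in uniformity. x' = x \<longrightarrow> y \<in> U)"
    by (auto simp: open_bit_def intro!: eventually_mono[OF ev])
qed

end

instance bit :: polish_space
proof
  show "\<exists>B::bit set set. countable B \<and> open = generate_topology B"
  proof (intro exI[of _ UNIV] conjI)
    show "countable (UNIV :: bit set set)"
      by (intro countable_finite) (simp add: UNIV_bit flip: Pow_UNIV)
    show "open = generate_topology (UNIV :: bit set set)"
      by (auto simp: fun_eq_iff open_bit_def intro: generate_topology.Basis)
  qed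
next
  fix X :: "nat \<Rightarrow> bit"
  assume "Cauchy X"
  then obtain M where M: "\<And>m n. m \<ge> M \<Longrightarrow> n \<ge> M \<Longrightarrow> dist (X m) (X n) < 1"
    unfolding Cauchy_def using zero_less_one by blast
  have "X n = X M" if "n \<ge> M" for n
    using M[OF that order_refl] by (simp add: dist_bit_def split: if_splits)
  then have "X \<longlonglongrightarrow> X M"
    by (intro tendsto_eventually eventually_sequentiallyI)
  then show "convergent X" by (auto simp: convergent_def)
qed

section \<open>The coin-tossing measure and its cylinders\<close>

lemma finite_UNIV_bit: "finite (UNIV :: bit set)" and card_UNIV_bit: "card (UNIV :: bit set) = 2"
  by (simp_all add: UNIV_bit)

definition coin_measure :: "cantor measure" where
  "coin_measure = PiM UNIV (\<lambda>_. uniform_count_measure UNIV)"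

interpretation coin: product_prob_space "\<lambda>_::nat. uniform_count_measure (UNIV :: bit set)" UNIV
proof -
  interpret prob_space "uniform_count_measure (UNIV :: bit set)"
    by (rule prob_space_uniform_count_measure) (auto simp: UNIV_bit)
  show "product_prob_space (\<lambda>_::nat. uniform_count_measure (UNIV :: bit set))"
    by unfold_locales
qed

interpretation coin_prob: prob_space coin_measure
  unfolding coin_measure_def by unfold_locales

lemma cantor_measure_eq: "cantor_measure = completion coin_measure"
  by (simp add: cantor_measure_def coin_measure_def)

lemma space_coin [simp]: "space coin_measure = UNIV"
  by (simp add: coin_measure_def space_PiM space_uniform_count_measure)

lemma sets_coin: "sets coin_measure = sets borel"
proof -
  have "sets (uniform_count_measure (UNIV :: bit set)) = sets borel"
    by (auto simp: sets_uniform_count_measure open_bit_def)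
  then have "sets coin_measure = sets (PiM UNIV (\<lambda>_::nat. borel :: bit measure))"
    unfolding coin_measure_def by (intro sets_PiM_cong) auto
  then show ?thesis by (simp only: sets_PiM_equal_borel)
qed

lemma proj_initial_eq_iff: "s \<in> seg 0 n \<Longrightarrow> proj 0 n x = s \<longleftrightarrow> (\<forall>i\<in>{..<n}. x i \<in> {s i})"
  by (auto simp: proj_def seg_def fun_eq_iff)

lemma coin_basic:
  assumes "s \<in> seg 0 n"
  shows "{x. proj 0 n x = s} \<in> sets coin_measure" "measure coin_measure {x. proj 0 n x = s} = 1 / 2 ^ n"
proof -
  have eq: "{x. proj 0 n x = s} = {x \<in> space (PiM UNIV (\<lambda>_::nat. uniform_count_measure (UNIV :: bit set))). \<forall>i\<in>{..<n}. x i \<in> {s i}}"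
    using proj_initial_eq_iff[OF assms] by (auto simp: space_PiM space_uniform_count_measure)
  show "{x. proj 0 n x = s} \<in> sets coin_measure"
    unfolding eq coin_measure_def
    by (intro sets.sets_Collect_finite_All sets_Collect_single') (auto simp: sets_uniform_count_measure)
  have "emeasure coin_measure {x. proj 0 n x = s} = (\<Prod>i<n. ennreal (1 / 2))"
    unfolding eq coin_measure_def
    by (subst coin.emeasure_PiM_Collect)
      (auto simp: sets_uniform_count_measure emeasure_uniform_count_measure finite_UNIV_bit card_UNIV_bit)
  also have "\<dots> = ennreal (\<Prod>i<n. 1 / 2)" by (rule prod_ennreal) simp
  finally show "measure coin_measure {x. proj 0 n x = s} = 1 / 2 ^ n"
    by (simp add: coin_prob.emeasure_eq_measure power_divide)
qed

lemma coin_cylinder: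
  assumes "S \<subseteq> seg 0 n"
  shows "{x. proj 0 n x \<in> S} \<in> sets coin_measure"
    "measure coin_measure {x. proj 0 n x \<in> S} = real (card S) / 2 ^ n"
proof -
  have eq: "{x. proj 0 n x \<in> S} = (\<Union>s\<in>S. {x. proj 0 n x = s})" by auto
  have fin: "finite S" using assms finite_subset finite_seg by blast
  show "{x. proj 0 n x \<in> S} \<in> sets coin_measure"
    unfolding eq using fin assms coin_basic(1) by (intro sets.finite_UN) auto
  have "measure coin_measure {x. proj 0 n x \<in> S} = (\<Sum>s\<in>S. measure coin_measure {x. proj 0 n x = s})"
    unfolding eq using fin assms coin_basic(1)
    by (intro coin_prob.finite_measure_finite_Union) (auto simp: disjoint_family_on_def)
  also have "\<dots> = (\<Sum>s\<in>S. 1 / 2 ^ n)"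
    using assms coin_basic(2) by (intro sum.cong) auto
  finally show "measure coin_measure {x. proj 0 n x \<in> S} = real (card S) / 2 ^ n" by simp
qed

lemma open_cantor_initial:
  assumes "open U" "x \<in> (U :: cantor set)"
  shows "\<exists>n. \<forall>y. proj 0 n y = proj 0 n x \<longrightarrow> y \<in> U"
proof -
  have "\<exists>X. x \<in> (\<Pi>\<^sub>E i\<in>UNIV. X i) \<and> (\<forall>i. openin euclidean (X i)) \<and>
      finite {i. X i \<noteq> topspace euclidean} \<and> (\<Pi>\<^sub>E i\<in>UNIV. X i) \<subseteq> U"
    by (rule product_topology_open_contains_basis[OF assms(1)[unfolded open_fun_def] assms(2)])
  then obtain X where X: "x \<in> (\<Pi>\<^sub>E i\<in>UNIV. X i)" "finite {i. X i \<noteq> UNIV}" "(\<Pi>\<^sub>E i\<in>UNIV. X i) \<subseteq> U"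
    unfolding topspace_euclidean by (elim exE conjE) (rule that)
  obtain n where "{i. X i \<noteq> UNIV} \<subseteq> {..<n}"
    using X(2)[unfolded finite_nat_iff_bounded] by (elim exE) (rule that)
  then have n: "\<And>i. X i \<noteq> UNIV \<Longrightarrow> i < n" by auto
  have "y \<in> U" if "proj 0 n y = proj 0 n x" for y
  proof -
    have "y i \<in> X i" for i
    proof (cases "i < n")
      case True
      then have "y i = x i" using fun_cong[OF that, of i] by (simp add: proj_def)
      then show ?thesis using PiE_mem[OF X(1), of i] by simp
    next
      case False
      then have "X i = UNIV" using n by blast
      then show ?thesis by simp
    qed
    then have "y \<in> (\<Pi>\<^sub>E i\<in>UNIV. X i)" by (simp add: PiE_UNIV_domain)
    then show ?thesis using X(3) by blast
  qed
  then show ?thesis by blast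
qed

lemma coin_null_open_cover:
  assumes "G \<in> null_sets cantor_measure" "e > 0"
  shows "\<exists>U. open U \<and> G \<subseteq> U \<and> measure coin_measure U < e"
proof -
  obtain B where B: "B \<in> null_sets coin_measure" "G \<subseteq> B"
    using assms(1) unfolding cantor_measure_eq null_sets_completion_iff2 by blast
  have "(INF U \<in> {U. B \<subseteq> U \<and> open U}. emeasure coin_measure U) = emeasure coin_measure B"
    using B(1) by (intro outer_regular[symmetric] sets_coin) (auto simp: null_sets_def sets_coin)
  also have "\<dots> < ennreal e" using B(1) assms(2) by auto
  finally obtain U where "B \<subseteq> U" "open U" "emeasure coin_measure U < ennreal e"
    unfolding INF_less_iff by blast
  then show ?thesis
    using B(2) assms(2) by (auto simp: coin_prob.emeasure_eq_measure ennreal_less_iff intro!: exI[of _ U])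
qed

lemma countable_cantor_rationals: "countable cantor_rationals"
proof -
  have "cantor_rationals \<subseteq> (\<Union>n. seg 0 n)"
  proof
    fix x assume "x \<in> cantor_rationals"
    then have "finite {i. x i \<noteq> 0}" by (simp only: cantor_rationals_def mem_Collect_eq)
    then obtain n where n: "{i. x i \<noteq> 0} \<subseteq> {..<n}"
      unfolding finite_nat_iff_bounded by (elim exE) (rule that)
    have "x i = 0" if "i \<notin> {0..<n}" for i
    proof (rule ccontr)
      assume "x i \<noteq> 0"
      then have "i \<in> {i. x i \<noteq> 0}" by (rule CollectI)
      with n have "i \<in> {..<n}" by (rule subsetD)
      then show False using that by simp
    qed
    then have "x \<in> seg 0 n" unfolding seg_def by blast
    then show "x \<in> (\<Union>n. seg 0 n)" by blast
  qed
  moreover have "countable (\<Union>n. seg 0 n)" by (intro countable_UN countableI_type countable_finite finite_seg)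
  ultimately show ?thesis by (rule countable_subset)
qed

lemma null_sets_cantor_subset:
  "B \<subseteq> A \<Longrightarrow> A \<in> null_sets cantor_measure \<Longrightarrow> B \<in> null_sets cantor_measure"
  unfolding cantor_measure_eq by (rule null_sets_completion_subset)

context block_system
begin

text \<open>With summable densities these sets are null by Borel-Cantelli, and every null set is
  contained in one of them. So F is a combinatorial code for a null set.\<close>

definition recurrent :: "(nat \<Rightarrow> cantor set) \<Rightarrow> cantor set" where
  "recurrent F = {x. \<exists>\<^sub>\<infinity>k. trunc k x \<in> F k}"

lemma measure_trunc: "F k \<subseteq> P k \<Longrightarrow> measure coin_measure {x. trunc k x \<in> F k} = dens F k"
  using coin_cylinder(2)[of "F k" "N k"] by (simp add: dens_def card_seg)

lemma recurrent_null:
  assumes "\<And>k. F k \<subseteq> P k" "summable (dens F)"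
  shows "recurrent F \<in> null_sets cantor_measure"
proof -
  define A where "A k = {x. trunc k x \<in> F k}" for k
  have "limsup A \<in> null_sets coin_measure"
  proof (rule borel_cantelli_limsup1)
    show "A k \<in> sets coin_measure" for k
      unfolding A_def by (rule coin_cylinder(1)[OF assms(1)])
    show "emeasure coin_measure (A k) < \<infinity>" for k
      by (simp add: coin_prob.emeasure_eq_measure)
    show "summable (\<lambda>k. measure coin_measure (A k))"
    proof -
      have "(\<lambda>k. measure coin_measure (A k)) = dens F"
        unfolding A_def by (rule ext) (rule measure_trunc[OF assms(1)])
      then show ?thesis using assms(2) by simp
    qed
  qed
  moreover have "limsup A = recurrent F"
    by (auto simp: limsup_INF_SUP recurrent_def INFM_nat_le A_def)
  ultimately show ?thesis
    unfolding cantor_measure_eq by (metis null_sets_completionI)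
qed

text \<open>Covers \<open>G\<close> by open sets of measure less than \<open>2\<^sup>-\<^sup>i\<close>; the \<open>i\<close>-th one is cut into cylinders at
  levels \<open>k \<ge> i\<close> only, so that a point of \<open>G\<close> is caught at infinitely many levels.\<close>

lemma null_subset_recurrent:
  assumes G: "G \<in> null_sets cantor_measure"
  shows "\<exists>F. (\<forall>k. F k \<subseteq> P k) \<and> summable (dens F) \<and> G \<subseteq> recurrent F"
proof -
  have "\<forall>i::nat. \<exists>U. open U \<and> G \<subseteq> U \<and> measure coin_measure U < (1/2) ^ i"
    using coin_null_open_cover[OF G] by simp
  then obtain U where U: "\<And>i. open (U i)" "\<And>i. G \<subseteq> U i" "\<And>i. measure coin_measure (U i) < (1/2) ^ i"
    by metis
  define C where "C i k = {s \<in> P k. \<forall>y. trunc k y = s \<longrightarrow> y \<in> U i}" for i k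
  \<comment> \<open>\<open>E i k\<close> keeps the words of level k whose cylinder lies in
    \<open>U i\<close> while no shorter one from level i on does. These cylinders are disjoint, so
    for fixed i their densities add up to at most the measure of \<open>U i\<close>.\<close>
  define E where "E i k = {s \<in> C i k. i \<le> k \<and> (\<forall>k'. i \<le> k' \<and> k' < k \<longrightarrow> trunc k' s \<notin> C i k')}" for i k
  define F where "F k = (\<Union>i\<le>k. E i k)" for k
  have E_sub: "E i k \<subseteq> P k" for i k by (auto simp: E_def C_def)
  have trunc_trunc: "trunc k' (trunc k x) = trunc k' x" if "k' < k" for k k' x
    using N_mono[of k' k] that by (intro proj_proj_initial) simp
  have sum_E: "(\<Sum>k\<in>{i..<n}. dens (E i) k) \<le> (1/2) ^ i" for i n
  proof -
    have "(\<Sum>k\<in>{i..<n}. dens (E i) k) = (\<Sum>k\<in>{i..<n}. measure coin_measure {x. trunc k x \<in> E i k})"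
      using E_sub by (intro sum.cong refl measure_trunc[symmetric])
    also have "\<dots> = measure coin_measure (\<Union>k\<in>{i..<n}. {x. trunc k x \<in> E i k})"
    proof (rule coin_prob.finite_measure_finite_Union[symmetric])
      show "(\<lambda>k. {x. trunc k x \<in> E i k}) ` {i..<n} \<subseteq> sets coin_measure"
        using coin_cylinder(1)[OF E_sub] by blast
      show "disjoint_family_on (\<lambda>k. {x. trunc k x \<in> E i k}) {i..<n}"
        unfolding disjoint_family_on_def
      proof (intro ballI impI)
        fix k k' assume kk: "k \<in> {i..<n}" "k' \<in> {i..<n}" "k \<noteq> k'"
        have disj: False if "a < b" "a \<in> {i..<n}" "trunc a x \<in> E i a" "trunc b x \<in> E i b" for a b x
        proof -
          have "trunc a (trunc b x) \<notin> C i a" using that(1,2,4) unfolding E_def by simp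
          moreover have "trunc a x \<in> C i a" using that(3) unfolding E_def by simp
          ultimately show False using trunc_trunc[OF that(1), of x] by simp
        qed
        show "{x. trunc k x \<in> E i k} \<inter> {x. trunc k' x \<in> E i k'} = {}"
        proof (rule equals0I)
          fix x assume "x \<in> {x. trunc k x \<in> E i k} \<inter> {x. trunc k' x \<in> E i k'}"
          then have tr: "trunc k x \<in> E i k" "trunc k' x \<in> E i k'" by simp_all
          show False
            using kk(3) disj[OF _ kk(1) tr] disj[OF _ kk(2) tr(2,1)] by (meson linorder_neqE_nat)
        qed
      qed
    qed simp
    also have "\<dots> \<le> measure coin_measure (U i)"
    proof (rule coin_prob.finite_measure_mono)
      show "(\<Union>k\<in>{i..<n}. {x. trunc k x \<in> E i k}) \<subseteq> U i" by (auto simp: E_def C_def)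
      show "U i \<in> sets coin_measure" using U(1) by (simp add: sets_coin)
    qed
    finally show ?thesis using U(3)[of i] by simp
  qed
  have "summable (dens F)"
  proof (rule summableI_nonneg_bounded)
    show "0 \<le> dens F n" for n by simp
    fix n
    have "dens F k \<le> (\<Sum>i\<le>k. dens (E i) k)" for k
      unfolding dens_def F_def sum_divide_distrib[symmetric]
      using card_UN_le[of "{..k}" "\<lambda>i. E i k"] by (intro divide_right_mono) (simp_all flip: of_nat_sum)
    then have "(\<Sum>k<n. dens F k) \<le> (\<Sum>k<n. \<Sum>i\<le>k. dens (E i) k)" by (intro sum_mono)
    also have "\<dots> = (\<Sum>i<n. \<Sum>k\<in>{i..<n}. dens (E i) k)"
    proof -
      have "(\<Sum>k<n. \<Sum>i\<le>k. dens (E i) k) = (\<Sum>k<n. \<Sum>i | i < n \<and> i \<le> k. dens (E i) k)"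
        by (intro sum.cong refl) auto
      also have "\<dots> = (\<Sum>i<n. \<Sum>k | k < n \<and> i \<le> k. dens (E i) k)"
        using sum.swap_restrict[of "{..<n}" "{..<n}" "\<lambda>k i. dens (E i) k" "\<lambda>k i. i \<le> k"] by simp
      also have "\<dots> = (\<Sum>i<n. \<Sum>k\<in>{i..<n}. dens (E i) k)"
        by (intro sum.cong refl) auto
      finally show ?thesis .
    qed
    also have "\<dots> \<le> (\<Sum>i<n. (1/2) ^ i)" by (intro sum_mono sum_E)
    also have "\<dots> \<le> (\<Sum>i. (1/2) ^ i)" by (intro sum_le_suminf summable_geometric) auto
    finally show "(\<Sum>k<n. dens F k) \<le> (\<Sum>i. (1/2) ^ i)" .
  qed
  moreover have "G \<subseteq> recurrent F"
  proof
    fix x assume x: "x \<in> G"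
    have "\<exists>k\<ge>i. trunc k x \<in> F k" for i
    proof -
      have "x \<in> U i" using U(2) x by blast
      from open_cantor_initial[OF U(1) this]
      obtain n where n: "\<forall>y. proj 0 n y = proj 0 n x \<longrightarrow> y \<in> U i" by (elim exE) (rule that)
      define k where "k = max i n"
      have "n \<le> N k"
        using strict_mono_imp_increasing[OF strict_mono_N, of k] by (simp add: k_def)
      have "y \<in> U i" if "trunc k y = trunc k x" for y
      proof -
        have "proj 0 n (trunc k y) = proj 0 n (trunc k x)" by (simp only: that)
        then have "proj 0 n y = proj 0 n x" by (simp only: proj_proj_initial[OF \<open>n \<le> N k\<close>])
        then show ?thesis using n by blast
      qed
      then have "trunc k x \<in> C i k" unfolding C_def by simp
      moreover have "i \<le> k" by (simp add: k_def)
      ultimately have ex: "\<exists>k. i \<le> k \<and> trunc k x \<in> C i k" by blast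
      define m where "m = (LEAST k. i \<le> k \<and> trunc k x \<in> C i k)"
      have m: "i \<le> m" "trunc m x \<in> C i m" using LeastI_ex[OF ex] by (simp_all add: m_def)
      have "\<not> (i \<le> k' \<and> trunc k' x \<in> C i k')" if "k' < m" for k'
        using not_less_Least[of k' "\<lambda>k. i \<le> k \<and> trunc k x \<in> C i k"] that unfolding m_def by blast
      then have "trunc m x \<in> E i m" using m by (simp add: E_def trunc_trunc)
      then show ?thesis using m by (auto simp: F_def)
    qed
    then show "x \<in> recurrent F" by (simp add: recurrent_def INFM_nat_le)
  qed
  moreover have "F k \<subseteq> P k" for k using E_sub by (auto simp: F_def)
  ultimately show ?thesis by blast
qed

text \<open>Read off the codes: translating all forbidden words of level k by the truncation of z
  does not change their number.\<close>

lemma null_translate: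
  assumes "G \<in> null_sets cantor_measure"
  shows "{x. x + z \<in> G} \<in> null_sets cantor_measure"
proof -
  obtain F where F: "\<And>k. F k \<subseteq> P k" "summable (dens F)" "G \<subseteq> recurrent F"
    using null_subset_recurrent[OF assms] by blast
  define F' where "F' k = (\<lambda>s. s + trunc k z) ` F k" for k
  have "card (F' k) = card (F k)" for k
    unfolding F'_def by (intro card_image inj_onI) simp
  then have "dens F' = dens F" by (simp add: dens_def fun_eq_iff)
  moreover have "F' k \<subseteq> P k" for k
  proof -
    interpret finite_boolean_group "P k" by (rule finite_boolean_group_seg)
    show ?thesis using F(1)[of k] by (auto simp: F'_def)
  qed
  ultimately have "recurrent F' \<in> null_sets cantor_measure"
    using F(2) by (intro recurrent_null) auto
  moreover have "{x. x + z \<in> G} \<subseteq> recurrent F'"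
  proof
    fix x assume "x \<in> {x. x + z \<in> G}"
    then have "\<exists>\<^sub>\<infinity>k. trunc k (x + z) \<in> F k" using F(3) by (auto simp: recurrent_def)
    then have "\<exists>\<^sub>\<infinity>k. trunc k x \<in> F' k"
    proof (rule INFM_mono)
      fix k assume "trunc k (x + z) \<in> F k"
      then have "trunc k (x + z) + trunc k z \<in> F' k" by (auto simp: F'_def)
      then show "trunc k x \<in> F' k" by (simp add: proj_add)
    qed
    then show "x \<in> recurrent F'" by (simp add: recurrent_def)
  qed
  ultimately show ?thesis by (metis null_sets_cantor_subset)
qed

lemma null_UN_translate:
  assumes "G \<in> null_sets cantor_measure" "countable X"
  shows "{x. \<exists>q\<in>X. x + q \<in> G} \<in> null_sets cantor_measure"
proof -
  have "{x. \<exists>q\<in>X. x + q \<in> G} = (\<Union>q\<in>X. {x. x + q \<in> G})" by blast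
  then show ?thesis using assms by (simp only: null_sets_UN' null_translate)
qed

end

section \<open>Conditions and branches\<close>

text \<open>Koenig's lemma: keep infinitely many indices K that agree on ever longer prefixes, each
  time by the infinite pigeonhole principle.\<close>

lemma koenig_sequences:
  fixes f :: "nat \<Rightarrow> nat \<Rightarrow> 'a"
  assumes "\<And>i. finite (S i)" "\<And>K i. f K i \<in> S i"
  shows "\<exists>g. \<forall>n. infinite {K. \<forall>i<n. f K i = g i}"
proof -
  define Q where "Q n h \<longleftrightarrow> infinite {K. \<forall>i<n. f K i = h i}" for n h
  have "\<exists>hs. \<forall>n. Q n (hs n) \<and> (\<forall>i<n. hs (Suc n) i = hs n i)"
  proof (rule dependent_nat_choice)
    show "\<exists>h. Q 0 h" by (simp add: Q_def)
  next
    fix h n assume "Q n h"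
    define A where "A = {K. \<forall>i<n. f K i = h i}"
    have "(\<lambda>K. f K n) ` A \<subseteq> S n" using assms(2) by auto
    then have "finite ((\<lambda>K. f K n) ` A)" using assms(1) by (rule finite_subset)
    then obtain K0 where K0: "infinite {K \<in> A. f K n = f K0 n}"
      using pigeonhole_infinite[of A "\<lambda>K. f K n"] \<open>Q n h\<close> unfolding Q_def A_def by blast
    have "{K \<in> A. f K n = f K0 n} = {K. \<forall>i<Suc n. f K i = (h(n := f K0 n)) i}"
      by (auto simp: A_def less_Suc_eq)
    then have "Q (Suc n) (h(n := f K0 n))" using K0 by (simp only: Q_def simp_thms)
    then show "\<exists>h'. Q (Suc n) h' \<and> (\<forall>i<n. h' i = h i)"
      by (intro exI[of _ "h(n := f K0 n)"]) simp
  qed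
  then obtain hs where hs: "\<And>n. Q n (hs n)" "\<And>n i. i < n \<Longrightarrow> hs (Suc n) i = hs n i" by blast
  define g where "g i = hs (Suc i) i" for i
  have "hs n i = g i" if "i < n" for n i
    using that
  proof (induction n)
    case (Suc n)
    then show ?case by (cases "i = n") (simp_all add: g_def hs(2))
  qed simp
  then have "{K. \<forall>i<n. f K i = hs n i} = {K. \<forall>i<n. f K i = g i}" for n by auto
  then have "infinite {K. \<forall>i<n. f K i = g i}" for n
    using hs(1)[of n] by (simp only: Q_def simp_thms)
  then show ?thesis by blast
qed

lemma proj_sum: "proj a b (sum f S) = (\<Sum>k\<in>S. proj a b (f k))"
proof (induction S rule: infinite_finite_induct)
  case (insert k S)
  show ?case unfolding sum.insert[OF insert.hyps] proj_add insert.IH by (rule refl)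
qed (simp_all add: proj_def fun_eq_iff)

context block_system
begin

text \<open>Since the levels tend to infinity, finitely many moves cost only finitely many blocks,
  and a diagonal argument handles countably many.\<close>

definition condition :: "(nat \<Rightarrow> cantor set) \<Rightarrow> (nat \<Rightarrow> cantor set) \<Rightarrow> bool" where
  "condition A B \<longleftrightarrow> (\<exists>l. filterlim l at_top sequentially \<and> (\<forall>\<^sub>F k in sequentially. good k (l k) (A k) (B k)))"

definition branch :: "(nat \<Rightarrow> cantor set) \<Rightarrow> cantor \<Rightarrow> bool" where
  "branch A x \<longleftrightarrow> (\<forall>\<^sub>F k in sequentially. blk k x \<in> A k)"

lemma trunc_trunc: "k \<le> K \<Longrightarrow> trunc k (trunc K x) = trunc k x"
  by (rule proj_proj_initial) (rule N_mono)

section \<open>Passage to infinitely many levels\<close>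

lemma avoids_trunc: "avoids k0 K F (trunc K z) \<sigma> A \<longleftrightarrow> avoids k0 K F z \<sigma> A"
proof -
  have "trunc k (x + trunc K z) = trunc k (x + z)" if "k \<in> {k0..K}" for k x
    using that by (simp add: proj_add trunc_trunc)
  then show ?thesis unfolding avoids_def by simp
qed

lemma escapable_trunc: "escapable k0 l A B K F (trunc K z) \<longleftrightarrow> escapable k0 l A B K F z"
  by (simp only: escapable_def avoids_trunc)

lemma escapable_decseq:
  assumes "escapable k0 l A B (Suc K) F z"
  shows "escapable k0 l A B K F z"
proof -
  obtain \<sigma> A' where \<sigma>: "\<sigma> \<in> P k0"
    and A': "\<forall>k\<in>{k0..<Suc K}. A' k \<subseteq> A k \<and> good k (l k) (A' k) (B k)"
    and av: "avoids k0 (Suc K) F z \<sigma> A'"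
    using assms unfolding escapable_def by blast
  have "avoids k0 K F z \<sigma> A'"
    unfolding avoids_def
  proof (rule ballI)
    fix k assume "k \<in> {k0..K}"
    then have "k \<in> {k0..Suc K}" by simp
    then show "\<forall>x. trunc k0 x = \<sigma> \<and> (\<forall>i\<in>{k0..<k}. blk i x \<in> A' i) \<longrightarrow> trunc k (x + z) \<notin> F k"
      by (rule av[unfolded avoids_def, THEN bspec])
  qed
  moreover have "\<forall>k\<in>{k0..<K}. A' k \<subseteq> A k \<and> good k (l k) (A' k) (B k)"
    using A' by (simp add: ball_simps less_Suc_eq)
  ultimately show ?thesis using \<sigma> unfolding escapable_def by blast
qed

text \<open>The escapable z form a decreasing sequence of sets of measure at least 1/2. The
  intersection has measure at least 1/2, so it is not contained in the null set Z.\<close>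

lemma exists_escapable:
  assumes F: "\<And>k. F k \<subseteq> P k" and g: "\<And>k. k0 \<le> k \<Longrightarrow> good k (Suc (l k)) (A k) (B k)"
    and small: "\<And>K. k0 \<le> K \<Longrightarrow> (\<Sum>k\<in>{k0..K}. dens F k) + (\<Sum>k\<in>{k0..<K}. 2 * (1/2) ^ k) \<le> 1 / 2"
    and Z: "Z \<in> null_sets cantor_measure"
  shows "\<exists>z. z \<notin> Z \<and> (\<forall>K\<ge>k0. escapable k0 l A B K F z)"
proof -
  define E where "E i = {z. escapable k0 l A B (k0 + i) F z}" for i
  have E_eq: "E i = {z. trunc (k0 + i) z \<in> {z \<in> P (k0 + i). escapable k0 l A B (k0 + i) F z}}" for i
    unfolding E_def by (simp only: escapable_trunc mem_Collect_eq proj_in_seg simp_thms)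
  have E_sets: "E i \<in> sets coin_measure" for i
    unfolding E_eq by (rule coin_cylinder(1)) blast
  have E_measure: "1 / 2 \<le> measure coin_measure (E i)" for i
  proof -
    let ?K = "k0 + i"
    let ?G = "{z \<in> P ?K. escapable k0 l A B ?K F z}" and ?B = "{z \<in> P ?K. \<not> escapable k0 l A B ?K F z}"
    have "real (card ?B) \<le> real (card (P ?K)) * ((\<Sum>k\<in>{k0..?K}. dens F k) + (\<Sum>k\<in>{k0..<?K}. 2 * (1/2) ^ k))"
      by (rule card_not_escapable_le[OF le_add1 F g])
    also have "\<dots> \<le> real (card (P ?K)) * (1 / 2)"
      by (intro mult_left_mono small) simp_all
    finally have B: "real (card ?B) \<le> real (card (P ?K)) / 2" by (simp only: times_divide_eq_right mult_1_right)
    have "card (?G \<union> ?B) = card ?G + card ?B" by (rule card_Un_disjoint) auto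
    moreover have "?G \<union> ?B = P ?K" by blast
    ultimately have "real (card (P ?K)) = real (card ?G) + real (card ?B)" by (simp only: of_nat_add)
    then have "real (card (P ?K)) / 2 \<le> real (card ?G)" using B by linarith
    moreover have "measure coin_measure (E i) = real (card ?G) / real (card (P ?K))"
    proof -
      have "real (card (P ?K)) = 2 ^ N ?K" by (simp add: card_seg)
      moreover have "?G \<subseteq> P ?K" by blast
      ultimately show ?thesis unfolding E_eq by (simp only: coin_cylinder(2))
    qed
    ultimately show ?thesis using card_P_pos[of ?K] by (simp add: pos_le_divide_eq)
  qed
  have dec: "decseq E"
    unfolding decseq_Suc_iff E_def add_Suc_right by (intro allI Collect_mono impI) (rule escapable_decseq)
  have "(\<lambda>i. measure coin_measure (E i)) \<longlonglongrightarrow> measure coin_measure (\<Inter>i. E i)"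
    by (rule coin_prob.finite_Lim_measure_decseq[OF _ dec]) (intro image_subsetI E_sets)
  then have "1 / 2 \<le> measure coin_measure (\<Inter>i. E i)"
    by (rule LIMSEQ_le_const) (intro exI allI impI E_measure)
  then have "measure coin_measure (\<Inter>i. E i) \<noteq> 0" by linarith
  then have "(\<Inter>i. E i) \<notin> null_sets coin_measure"
    by (rule contrapos_nn) (simp add: null_sets_def measure_def)
  moreover have "(\<Inter>i. E i) \<in> sets coin_measure" by (intro sets.countable_INT'' E_sets countableI_type) (use sets.top[of coin_measure] in simp)
  ultimately have "(\<Inter>i. E i) \<notin> null_sets cantor_measure"
    unfolding cantor_measure_eq by (simp only: null_sets_completion_iff simp_thms)
  then have "\<not> (\<Inter>i. E i) \<subseteq> Z" using null_sets_cantor_subset[OF _ Z] by blast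
  then obtain z where z: "z \<notin> Z" "z \<in> (\<Inter>i. E i)" unfolding subset_iff by blast
  have "escapable k0 l A B K F z" if "k0 \<le> K" for K
    using INT_D[OF z(2), of "K - k0"] that by (simp add: E_def)
  then show ?thesis using z(1) by blast
qed

text \<open>The witnesses depend on K, but each block has only finitely many subsets and there are
  finitely many stems. Koenig's lemma gives a stem and a sequence each of whose finite parts agrees
  with witnesses for arbitrarily large K.\<close>

lemma escapable_limit:
  assumes g: "\<And>k. k0 \<le> k \<Longrightarrow> good k (Suc (l k)) (A k) (B k)"
    and esc: "\<And>K. k0 \<le> K \<Longrightarrow> escapable k0 l A B K F z"
  shows "\<exists>\<sigma>\<in>P k0. \<exists>A'. (\<forall>k. A' k \<subseteq> A k) \<and> (\<forall>k\<ge>k0. good k (l k) (A' k) (B k)) \<and> (\<forall>K. avoids k0 K F z \<sigma> A')"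
proof -
  define Q where "Q i \<sigma> A' \<longleftrightarrow> \<sigma> \<in> P k0 \<and>
    (\<forall>k\<in>{k0..<k0 + i}. A' k \<subseteq> A k \<and> good k (l k) (A' k) (B k)) \<and> avoids k0 (k0 + i) F z \<sigma> A'" for i \<sigma> A'
  have "\<exists>\<sigma> A'. Q i \<sigma> A'" for i
    using esc[of "k0 + i"] unfolding escapable_def Q_def by auto
  then obtain \<sigma> A' where Q: "\<And>i. Q i (\<sigma> i) (A' i)" by metis
  have \<sigma>: "\<And>i. \<sigma> i \<in> P k0"
    and A': "\<And>i k. k \<in> {k0..<k0 + i} \<Longrightarrow> A' i k \<subseteq> A k \<and> good k (l k) (A' i k) (B k)"
    and av: "\<And>i. avoids k0 (k0 + i) F z (\<sigma> i) (A' i)"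
    using Q unfolding Q_def by blast+
  \<comment> \<open>Coordinate 0 stores the stem as a singleton so that all coordinates have one
    type; coordinate Suc k stores the set for block k, with the default {} outside the
    window.\<close>
  define f where "f i n = (case n of 0 \<Rightarrow> {\<sigma> i} | Suc k \<Rightarrow> if k \<in> {k0..<k0 + i} then A' i k else {})" for i n
  define S where "S n = (case n of 0 \<Rightarrow> (\<lambda>s. {s}) ` P k0 | Suc k \<Rightarrow> if k0 \<le> k then Pow (A k) else {{}})" for n
  have "\<exists>h. \<forall>n. infinite {i. \<forall>j<n. f i j = h j}"
  proof (rule koenig_sequences[of S])
    show "finite (S n)" for n
      using goodD(4)[OF g] by (cases n) (simp_all add: S_def)
    show "f i n \<in> S n" for i n
    proof (cases n)
      case 0
      then show ?thesis using \<sigma>[of i] by (simp add: f_def S_def)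
    next
      case (Suc k)
      show ?thesis
      proof (cases "k \<in> {k0..<k0 + i}")
        case True
        then show ?thesis using A'[OF True] Suc by (simp add: f_def S_def)
      next
        case False
        then show ?thesis using Suc by (simp add: f_def S_def)
      qed
    qed
  qed
  then obtain h where h: "\<And>n. infinite {i. \<forall>j<n. f i j = h j}" by blast
  have h_ex: "\<exists>i\<ge>m. \<forall>j<n. f i j = h j" for m n
    using h[of n] unfolding infinite_nat_iff_unbounded_le by blast
  obtain i0 where "f i0 0 = h 0" using h_ex[of 0 1] by auto
  then have h0: "h 0 = {\<sigma> i0}" by (simp add: f_def)
  define A'' where "A'' k = h (Suc k)" for k
  have A''_sub: "A'' k \<subseteq> A k" for k
  proof -
    obtain i where "f i (Suc k) = h (Suc k)" using h_ex[of 0 "Suc (Suc k)"] by auto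
    moreover have "f i (Suc k) \<subseteq> A k"
    proof (cases "k \<in> {k0..<k0 + i}")
      case True
      then show ?thesis using A'[OF True] by (simp add: f_def)
    next
      case False
      then show ?thesis unfolding f_def by (simp only: nat.case if_False empty_subsetI)
    qed
    ultimately show ?thesis unfolding A''_def by simp
  qed
  have A''_good: "good k (l k) (A'' k) (B k)" if "k0 \<le> k" for k
  proof -
    obtain i where i': "Suc k \<le> i" "\<forall>j<Suc (Suc k). f i j = h j"
      using h_ex[of "Suc k" "Suc (Suc k)"] by (elim exE conjE) (rule that)
    have i: "k < i" "f i (Suc k) = h (Suc k)" using i'(1) i'(2)[rule_format, of "Suc k"] by simp_all
    have "k \<in> {k0..<k0 + i}" using \<open>k0 \<le> k\<close> i(1) by simp
    then show ?thesis using A'[of k i] i(2) by (simp add: A''_def f_def)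
  qed
  have av'': "avoids k0 K F z (\<sigma> i0) A''" for K
    unfolding avoids_def
  proof (intro ballI allI impI, elim conjE)
    fix k x assume k: "k \<in> {k0..K}" and x: "trunc k0 x = \<sigma> i0" "\<forall>j\<in>{k0..<k}. blk j x \<in> A'' j"
    obtain i where i: "k \<le> i" "\<forall>j<Suc k. f i j = h j"
      using h_ex[of k "Suc k"] by (elim exE conjE) (rule that)
    have "f i 0 = h 0" by (rule i(2)[rule_format]) simp
    then have "\<sigma> i = \<sigma> i0" using h0 by (simp add: f_def)
    then have "trunc k0 x = \<sigma> i" using x(1) by (simp only:)
    moreover have "blk j x \<in> A' i j" if j: "j \<in> {k0..<k}" for j
    proof -
      have "f i (Suc j) = h (Suc j)" by (rule i(2)[rule_format]) (use j in simp)
      then have "A' i j = A'' j" using j i(1) by (simp add: f_def A''_def)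
      then show ?thesis using x(2) j by (simp only:)
    qed
    moreover have "k \<in> {k0..k0 + i}" using k i(1) by simp
    ultimately show "trunc k (x + z) \<notin> F k"
      by (intro av[of i, unfolded avoids_def, rule_format] conjI ballI)
  qed
  show ?thesis
    by (intro bexI[OF _ \<sigma>[of i0]] exI[of _ A''] conjI allI impI A''_sub A''_good av'')
qed

text \<open>Only finitely many blocks of x have to be overwritten: the stem by
  \<open>\<sigma>\<close>, and the blocks from k0 to k1, where x may still be outside A, by
  arbitrary elements of A.\<close>

lemma redirect_branch:
  assumes \<sigma>: "\<sigma> \<in> P k0" and ne: "\<And>k. k0 \<le> k \<Longrightarrow> A k \<noteq> {} \<and> A k \<subseteq> V k" and x: "branch A x"
  shows "\<exists>q\<in>cantor_rationals. trunc k0 (x + q) = \<sigma> \<and> (\<forall>k\<ge>k0. blk k (x + q) \<in> A k)"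
proof -
  obtain k1 where k1: "k0 \<le> k1" "\<And>k. k1 \<le> k \<Longrightarrow> blk k x \<in> A k"
  proof -
    obtain m where "\<And>k. m \<le> k \<Longrightarrow> blk k x \<in> A k"
      using x unfolding branch_def eventually_sequentially by blast
    then show thesis using that[of "max k0 m"] by simp
  qed
  have "\<forall>k. \<exists>a. k0 \<le> k \<longrightarrow> a \<in> A k" using ne by blast
  then obtain a where a: "\<And>k. k0 \<le> k \<Longrightarrow> a k \<in> A k" by metis
  have aV: "a k \<in> V k" if "k0 \<le> k" for k using a[OF that] ne[OF that] by blast
  \<comment> \<open>The summand \<open>trunc k1 x\<close> erases the first k1 blocks of x, because
    every element is its own inverse.\<close>
  define q where "q = \<sigma> + (\<Sum>k\<in>{k0..<k1}. a k) + trunc k1 x"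
  have sum_trunc: "trunc k0 (\<Sum>k\<in>{k0..<k1}. a k) = 0"
    unfolding proj_sum
  proof (intro sum.neutral ballI)
    fix k assume "k \<in> {k0..<k1}"
    then show "trunc k0 (a k) = 0"
      using proj_seg_disjoint[OF aV[of k]] N_mono[of k0 k] by simp
  qed
  have "trunc k0 (x + q) = \<sigma>"
    using trunc_trunc[OF k1(1), of x] by (simp add: q_def proj_add sum_trunc proj_seg[OF \<sigma>] ac_simps)
  moreover have "blk j (x + q) \<in> A j" if j: "k0 \<le> j" for j
  proof -
    have \<sigma>j: "blk j \<sigma> = 0" using proj_seg_disjoint[OF \<sigma>] N_mono[OF j] by simp
    have blk_a: "blk j (a k) = (if k = j then a j else 0)" if "k0 \<le> k" for k
    proof (cases k j rule: linorder_cases)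
      case less
      then show ?thesis using proj_seg_disjoint[OF aV[OF that]] N_mono[of "Suc k" j] by simp
    next
      case equal
      then show ?thesis using proj_seg[OF aV[OF that]] by simp
    next
      case greater
      then show ?thesis using proj_seg_disjoint[OF aV[OF that]] N_mono[of "Suc j" k] by simp
    qed
    have blk_sum: "blk j (\<Sum>k\<in>{k0..<k1}. a k) = (if j < k1 then a j else 0)"
    proof -
      have "blk j (\<Sum>k\<in>{k0..<k1}. a k) = (\<Sum>k\<in>{k0..<k1}. if k = j then a j else 0)"
        unfolding proj_sum by (intro sum.cong refl blk_a) simp
      then show ?thesis using j by (simp add: sum.delta)
    qed
    show ?thesis
    proof (cases "j < k1")
      case True
      have "blk j (trunc k1 x) = blk j x"
        using True N_mono[of "Suc j" k1] by (auto simp: proj_def fun_eq_iff)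
      then have "blk j (x + q) = a j"
        using True by (simp add: q_def proj_add \<sigma>j blk_sum ac_simps)
      then show ?thesis using a[OF j] by simp
    next
      case False
      then have "blk j (trunc k1 x) = 0"
        using proj_seg_disjoint[OF proj_in_seg] N_mono[of k1 j] by simp
      then have "blk j (x + q) = blk j x"
        using False by (simp add: q_def proj_add \<sigma>j blk_sum)
      then show ?thesis using k1(2)[of j] False by simp
    qed
  qed
  moreover have "q \<in> cantor_rationals"
  proof -
    have "q i = 0" if "N k1 \<le> i" for i
    proof -
      have blk_free: "y i = 0" if "y \<in> seg c d" "d \<le> N k1" for y c d
        using that \<open>N k1 \<le> i\<close> by (simp add: seg_def)
      have "\<sigma> i = 0" using blk_free[OF \<sigma>] N_mono[OF k1(1)] by simp
      moreover have "trunc k1 x i = 0" using blk_free[OF proj_in_seg, of "N k1"] by simp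
      moreover have "(\<Sum>k\<in>{k0..<k1}. a k) i = 0"
      proof -
        have "(\<Sum>k\<in>T. a k) i = 0" if "T \<subseteq> {k0..<k1}" "finite T" for T
          using that(2,1)
        proof (induction T rule: finite_induct)
          case (insert k T)
          have "a k i = 0" using insert.prems blk_free[OF aV[of k]] N_mono[of "Suc k" k1] by simp
          then show ?case using insert by simp
        qed simp
        then show ?thesis by simp
      qed
      ultimately show ?thesis by (simp add: q_def)
    qed
    then have "{i. q i \<noteq> 0} \<subseteq> {..<N k1}" using not_le by (blast intro: ccontr)
    then have "finite {i. q i \<noteq> 0}" by (rule finite_subset) simp
    then show ?thesis by (simp only: cantor_rationals_def mem_Collect_eq)
  qed
  ultimately show ?thesis by blast
qed


lemma condition_sym: "condition A B \<Longrightarrow> condition B A"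
  unfolding condition_def by (metis (mono_tags, lifting) eventually_mono goodD(3))

text \<open>Every block gives up one level. The start k0 is so late that the tail of the failure
  bounds is at most 1/2. A branch obeys A' only eventually and has an arbitrary beginning, so it
  must first be moved onto the stem by a rational q.\<close>

lemma exists_avoiding_condition:
  assumes cond: "condition A B" and F: "\<And>k. F k \<subseteq> P k" "summable (dens F)"
    and Z: "Z \<in> null_sets cantor_measure"
  shows "\<exists>z A'. z \<notin> Z \<and> (\<forall>k. A' k \<subseteq> A k) \<and> condition A' B \<and>
    (\<forall>x. branch A' x \<longrightarrow> (\<exists>q\<in>cantor_rationals. x + q + z \<notin> recurrent F))"
proof -
  obtain l where l: "filterlim l at_top sequentially" "\<forall>\<^sub>F k in sequentially. good k (l k) (A k) (B k)"
    using cond unfolding condition_def by blast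
  define l' where "l' k = l k - 1" for k
  have "\<forall>\<^sub>F k in sequentially. 1 \<le> l k" using l(1) unfolding filterlim_at_top by blast
  with l(2) have "\<forall>\<^sub>F k in sequentially. good k (Suc (l' k)) (A k) (B k)"
    by eventually_elim (simp add: l'_def)
  then obtain k2 where k2: "\<And>k. k2 \<le> k \<Longrightarrow> good k (Suc (l' k)) (A k) (B k)"
    unfolding eventually_sequentially by blast
  define h where "h k = dens F k + 2 * (1/2) ^ k" for k
  have h: "summable h" unfolding h_def
    by (intro summable_add summable_mult summable_geometric F) auto
  have h0: "0 \<le> h k" for k by (simp add: h_def)
  obtain k3 where k3: "\<And>n. k3 \<le> n \<Longrightarrow> norm (\<Sum>i. h (i + n)) < 1 / 2"
    using suminf_exist_split[OF _ h, of "1 / 2"] by auto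
  define k0 where "k0 = max k2 k3"
  have g: "good k (Suc (l' k)) (A k) (B k)" if "k0 \<le> k" for k
    using k2[of k] that by (simp add: k0_def)
  have small: "(\<Sum>k\<in>{k0..K}. dens F k) + (\<Sum>k\<in>{k0..<K}. 2 * (1/2) ^ k) \<le> 1 / 2" if "k0 \<le> K" for K
  proof -
    have "(\<Sum>k\<in>{k0..<K}. 2 * (1/2::real) ^ k) \<le> (\<Sum>k\<in>{k0..K}. 2 * (1/2) ^ k)"
      by (rule sum_mono2) auto
    then have "(\<Sum>k\<in>{k0..K}. dens F k) + (\<Sum>k\<in>{k0..<K}. 2 * (1/2) ^ k) \<le> (\<Sum>k\<in>{k0..K}. h k)"
      unfolding h_def sum.distrib by simp
    also have "\<dots> = (\<Sum>i<Suc K - k0. h (i + k0))"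
      by (rule sum.reindex_bij_witness[of _ "\<lambda>i. i + k0" "\<lambda>k. k - k0"]) auto
    also have "\<dots> \<le> (\<Sum>i. h (i + k0))"
      using h h0 by (intro sum_le_suminf) (auto simp: summable_iff_shift)
    also have "\<dots> < 1 / 2" using k3[of k0] by (simp add: k0_def)
    finally show ?thesis by simp
  qed
  obtain z where z: "z \<notin> Z" "\<And>K. k0 \<le> K \<Longrightarrow> escapable k0 l' A B K F z"
    using exists_escapable[OF F(1) g small Z] by blast
  obtain \<sigma> A' where \<sigma>: "\<sigma> \<in> P k0" and A': "\<And>k. A' k \<subseteq> A k" "\<And>k. k0 \<le> k \<Longrightarrow> good k (l' k) (A' k) (B k)"
    and av: "\<And>K. avoids k0 K F z \<sigma> A'"
    using escapable_limit[OF g z(2)] by blast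
  have "filterlim l' at_top sequentially"
    unfolding filterlim_at_top
  proof
    fix m
    have "\<forall>\<^sub>F k in sequentially. m + 1 \<le> l k" using l(1) unfolding filterlim_at_top by blast
    then show "\<forall>\<^sub>F k in sequentially. m \<le> l' k" by eventually_elim (simp add: l'_def)
  qed
  moreover have "\<forall>\<^sub>F k in sequentially. good k (l' k) (A' k) (B k)"
    using A'(2) unfolding eventually_sequentially by blast
  ultimately have "condition A' B" unfolding condition_def by blast
  moreover have "\<exists>q\<in>cantor_rationals. x + q + z \<notin> recurrent F" if x: "branch A' x" for x
  proof -
    have "A' k \<noteq> {} \<and> A' k \<subseteq> V k" if "k0 \<le> k" for k
      using goodD(1,2)[OF A'(2)[OF that]] by (rule conjI)
    from redirect_branch[OF \<sigma> this x]
    obtain q where q: "q \<in> cantor_rationals" "trunc k0 (x + q) = \<sigma>" "\<And>k. k0 \<le> k \<Longrightarrow> blk k (x + q) \<in> A' k"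
      by blast
    have "trunc k (x + q + z) \<notin> F k" if "k0 \<le> k" for k
      by (rule av[of k, unfolded avoids_def, rule_format]) (use that q(2,3) in simp_all)
    then have "\<forall>\<^sub>F k in sequentially. trunc k (x + q + z) \<notin> F k"
      unfolding eventually_sequentially by blast
    then have "x + q + z \<notin> recurrent F"
      by (simp add: recurrent_def frequently_def cofinite_eq_sequentially)
    then show ?thesis using q(1) by blast
  qed
  ultimately show ?thesis using z(1) A'(1) by blast
qed

section \<open>Refinement modulo finitely many blocks, and countable chains\<close>

definition refines :: "(nat \<Rightarrow> cantor set) \<times> (nat \<Rightarrow> cantor set) \<Rightarrow> (nat \<Rightarrow> cantor set) \<times> (nat \<Rightarrow> cantor set) \<Rightarrow> bool" where
  "refines p q \<longleftrightarrow> (\<forall>\<^sub>F k in sequentially. fst p k \<subseteq> fst q k \<and> snd p k \<subseteq> snd q k)"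

lemma refines_refl: "refines p p" by (simp add: refines_def)

lemma refines_trans: "refines p q \<Longrightarrow> refines q r \<Longrightarrow> refines p r"
  unfolding refines_def by (erule (1) eventually_elim2) blast

text \<open>Diagonalisation: block k follows the last condition n \<le> k that is already good at k,
  contained there in all earlier ones, and of level at least n. The last clause makes the levels of
  the diagonal tend to infinity.\<close>

lemma exists_pseudo_intersection:
  assumes d: "\<And>n. condition (fst (d n)) (snd (d n))" "\<And>n. refines (d (Suc n)) (d n)"
  shows "\<exists>r. condition (fst r) (snd r) \<and> (\<forall>n. refines r (d n))"
proof -
  have "\<forall>n. \<exists>l. filterlim l at_top sequentially \<and> (\<forall>\<^sub>F k in sequentially. good k (l k) (fst (d n) k) (snd (d n) k))"
    using d(1) unfolding condition_def by blast
  then obtain l where l: "\<And>n. filterlim (l n) at_top sequentially"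
    "\<And>n. \<forall>\<^sub>F k in sequentially. good k (l n k) (fst (d n) k) (snd (d n) k)"
    by metis
  have ref: "refines (d n) (d m)" if "m \<le> n" for m n
    using that by (induction n rule: dec_induct) (auto intro: refines_refl refines_trans d(2))
  define E where "E n k \<longleftrightarrow> good k (l n k) (fst (d n) k) (snd (d n) k) \<and> n \<le> l n k \<and>
    (\<forall>m\<in>{..n}. fst (d n) k \<subseteq> fst (d m) k \<and> snd (d n) k \<subseteq> snd (d m) k)" for n k
  have E: "\<forall>\<^sub>F k in sequentially. E n k" for n
    unfolding E_def using l(2)[of n] l(1)[of n] ref[of _ n] unfolding refines_def filterlim_at_top
    by (intro eventually_conj eventually_ball_finite) auto
  define i where "i k = Max {n. n \<le> k \<and> (n = 0 \<or> E n k)}" for k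
  have i_in: "i k \<le> k \<and> (i k = 0 \<or> E (i k) k)" for k
  proof -
    have "i k \<in> {n. n \<le> k \<and> (n = 0 \<or> E n k)}"
      unfolding i_def by (rule Max_in) auto
    then show ?thesis by simp
  qed
  have i_ge: "\<forall>\<^sub>F k in sequentially. m \<le> i k" for m
    using E[of m] eventually_ge_at_top[of m]
  proof eventually_elim
    case (elim k)
    then show ?case unfolding i_def by (intro Max_ge) auto
  qed
  have Ei: "\<forall>\<^sub>F k in sequentially. E (i k) k"
  proof -
    have "E (i k) k" if "1 \<le> i k" for k using i_in[of k] that by auto
    then show ?thesis using i_ge[of 1] by (rule eventually_mono[rotated])
  qed
  define r where "r = (\<lambda>k. fst (d (i k)) k, \<lambda>k. snd (d (i k)) k)"
  have "condition (fst r) (snd r)"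
    unfolding condition_def
  proof (intro exI conjI)
    show "filterlim (\<lambda>k. l (i k) k) at_top sequentially"
      unfolding filterlim_at_top
    proof
      fix m
      show "\<forall>\<^sub>F k in sequentially. m \<le> l (i k) k"
        using Ei i_ge[of m] by eventually_elim (auto simp: E_def)
    qed
    show "\<forall>\<^sub>F k in sequentially. good k (l (i k) k) (fst r k) (snd r k)"
      using Ei by eventually_elim (simp add: E_def r_def)
  qed
  moreover have "refines r (d m)" for m
    unfolding refines_def using Ei i_ge[of m] by eventually_elim (auto simp: E_def r_def)
  ultimately show ?thesis by blast
qed

lemma condition_top: "condition V V"
  unfolding condition_def
  by (rule exI[of _ "\<lambda>k. k"]) (simp add: good_start filterlim_ident)

lemma exists_lower_bound:
  assumes C: "countable C" "\<And>p. p \<in> C \<Longrightarrow> condition (fst p) (snd p)"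
    "\<And>p q. p \<in> C \<Longrightarrow> q \<in> C \<Longrightarrow> refines p q \<or> refines q p"
  shows "\<exists>r. condition (fst r) (snd r) \<and> (\<forall>p\<in>C. refines r p)"
proof (cases "C = {}")
  case True
  then show ?thesis using condition_top by (intro exI[of _ "(V, V)"]) simp
next
  case False
  define c where "c = from_nat_into C"
  have c: "c n \<in> C" for n using from_nat_into[OF False] by (simp add: c_def)
  \<comment> \<open>The running minimum of an enumeration of the chain, which turns an arbitrary
    countable chain into a descending sequence.\<close>
  define d where "d = rec_nat (c 0) (\<lambda>n p. if refines (c (Suc n)) p then c (Suc n) else p)"
  have d_Suc: "d (Suc n) = (if refines (c (Suc n)) (d n) then c (Suc n) else d n)" and d_0: "d 0 = c 0" for n
    by (simp_all add: d_def)
  have dC: "d n \<in> C" for n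
    by (induction n) (simp_all add: d_0 d_Suc c)
  have "refines (d (Suc n)) (d n)" for n by (simp add: d_Suc refines_refl)
  then obtain r where r: "condition (fst r) (snd r)" "\<And>n. refines r (d n)"
    using exists_pseudo_intersection[of d] C(2) dC by blast
  have "refines (d n) (c n)" for n
  proof (cases n)
    case 0
    then show ?thesis by (simp add: d_0 refines_refl)
  next
    case (Suc m)
    then show ?thesis using C(3)[OF dC[of m] c[of n]] by (auto simp: d_Suc refines_refl)
  qed
  then have rc: "refines r (c n)" for n using r(2) refines_trans by blast
  have "refines r p" if "p \<in> C" for p
  proof -
    obtain n where "p = c n" using from_nat_into_surj[OF C(1) \<open>p \<in> C\<close>] unfolding c_def by metis
    then show ?thesis using rc by simp
  qed
  then show ?thesis using r(1) by blast
qed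

section \<open>Branches that meet the null set\<close>

lemma exists_blocks:
  assumes "\<And>k. a k \<in> V k"
  shows "\<exists>x. \<forall>k. blk k x = a k"
proof -
  define x where "x i = a (LEAST k. i < N (Suc k)) i" for i
  have "blk k x = a k" for k
  proof
    fix i
    show "blk k x i = a k i"
    proof (cases "i \<in> {N k..<N (Suc k)}")
      case True
      have "(LEAST j. i < N (Suc j)) = k"
      proof (rule Least_equality)
        show "i < N (Suc k)" using True by simp
        fix j assume "i < N (Suc j)"
        then show "k \<le> j" using True N_mono[of "Suc j" k] by (cases "k \<le> j") auto
      qed
      then show ?thesis using True by (simp add: proj_def x_def)
    next
      case False
      then have "a k i = 0" using assms[of k] unfolding seg_def by blast
      then show ?thesis using False unfolding proj_def by (simp only: if_False)
    qed
  qed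
  then show ?thesis by blast
qed

definition null_target :: "cantor set" where
  "null_target = {x. \<exists>\<^sub>\<infinity>k. blk k x \<in> H k}"

lemma exists_branch_into_target_aux:
  assumes A: "\<forall>\<^sub>F k in sequentially. A k \<noteq> {} \<and> A k \<subseteq> V k"
    and inf: "\<exists>\<^sub>\<infinity>k. \<exists>x\<in>A k. x + blk k w \<in> H k"
  shows "\<exists>x. branch A x \<and> x + w \<in> null_target"
proof -
  \<comment> \<open>A hitting value is taken where one exists and any member of A k otherwise, so
    the point is a branch and hits as often as possible.\<close>
  define ok where "ok k y \<longleftrightarrow> y \<in> A k \<and> ((\<exists>x\<in>A k. x + blk k w \<in> H k) \<longrightarrow> y + blk k w \<in> H k)" for k y
  define a where "a k = (if A k \<noteq> {} \<and> A k \<subseteq> V k then SOME y. ok k y else 0)" for k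
  have ok: "ok k (a k)" if "A k \<noteq> {} \<and> A k \<subseteq> V k" for k
  proof -
    have "\<exists>y. ok k y" using that unfolding ok_def by blast
    then show ?thesis using that unfolding a_def by (simp add: someI_ex)
  qed
  have "a k \<in> V k" for k
  proof (cases "A k \<noteq> {} \<and> A k \<subseteq> V k")
    case True
    then show ?thesis using ok[OF True] unfolding ok_def by blast
  next
    case False
    then show ?thesis unfolding a_def if_not_P[OF False] by (simp add: seg_def)
  qed
  then obtain x where x: "\<And>k. blk k x = a k" using exists_blocks by blast
  have "branch A x"
    unfolding branch_def x using A by eventually_elim (use ok in \<open>auto simp: ok_def\<close>)
  moreover have "\<exists>\<^sub>\<infinity>k. blk k (x + w) \<in> H k"
  proof -
    have "\<forall>\<^sub>\<infinity>k. A k \<noteq> {} \<and> A k \<subseteq> V k" using A by (simp add: cofinite_eq_sequentially)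
    with inf have "\<exists>\<^sub>\<infinity>k. (\<exists>x\<in>A k. x + blk k w \<in> H k) \<and> (A k \<noteq> {} \<and> A k \<subseteq> V k)"
      by (rule INFM_conjI)
    then show ?thesis
    proof (rule INFM_mono)
      fix k assume k: "(\<exists>x\<in>A k. x + blk k w \<in> H k) \<and> (A k \<noteq> {} \<and> A k \<subseteq> V k)"
      then have "a k + blk k w \<in> H k" using ok[of k] unfolding ok_def by blast
      then show "blk k (x + w) \<in> H k" unfolding proj_add x .
    qed
  qed
  ultimately show ?thesis unfolding null_target_def by blast
qed

text \<open>At almost every block one of the two sets hits, so one of them hits infinitely often.
  Which one depends on w, and this decides to which of the two strongly meager sets the new point
  belongs.\<close>

lemma exists_branch_into_target:
  assumes "condition A B"
  shows "\<exists>x. (branch A x \<or> branch B x) \<and> x + w \<in> null_target"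
proof -
  obtain l where l: "\<forall>\<^sub>F k in sequentially. good k (l k) (A k) (B k)"
    using assms unfolding condition_def by blast
  have A: "\<forall>\<^sub>F k in sequentially. A k \<noteq> {} \<and> A k \<subseteq> V k"
    using l by eventually_elim (rule conjI, erule goodD(1), erule goodD(2))
  have B: "\<forall>\<^sub>F k in sequentially. B k \<noteq> {} \<and> B k \<subseteq> V k"
    using l by eventually_elim (drule goodD(3), rule conjI, erule goodD(1), erule goodD(2))
  have "\<forall>\<^sub>F k in sequentially. (\<exists>x\<in>A k. x + blk k w \<in> H k) \<or> (\<exists>x\<in>B k. x + blk k w \<in> H k)"
    using l by eventually_elim (rule good_hit[OF _ proj_in_seg])
  then have "\<exists>\<^sub>\<infinity>k. (\<exists>x\<in>A k. x + blk k w \<in> H k) \<or> (\<exists>x\<in>B k. x + blk k w \<in> H k)"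
    by (intro eventually_frequently) (simp_all add: cofinite_eq_sequentially)
  then have "(\<exists>\<^sub>\<infinity>k. \<exists>x\<in>A k. x + blk k w \<in> H k) \<or> (\<exists>\<^sub>\<infinity>k. \<exists>x\<in>B k. x + blk k w \<in> H k)"
    by (simp only: frequently_disj_iff)
  then show ?thesis
    using exists_branch_into_target_aux[OF A] exists_branch_into_target_aux[OF B] by blast
qed

lemma null_target_null: "null_target \<in> null_sets cantor_measure"
proof -
  \<comment> \<open>The shift of the index is needed because block j is visible only in the
    truncation to Suc j blocks.\<close>
  define F where "F k = (case k of 0 \<Rightarrow> {} | Suc j \<Rightarrow> {s \<in> P (Suc j). blk j s \<in> H j})" for k
  have F_sub: "F k \<subseteq> P k" for k by (auto simp: F_def split: nat.split)
  have "dens F (Suc j) \<le> (1/2) ^ j" for j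
  proof -
    have "F (Suc j) \<subseteq> (\<lambda>(\<sigma>, h). \<sigma> + h) ` (P j \<times> H j)"
    proof
      fix s assume "s \<in> F (Suc j)"
      then have s: "s \<in> P (Suc j)" "blk j s \<in> H j" by (simp_all add: F_def)
      have "s = trunc j s + blk j s" using trunc_Suc[of j s] proj_seg[OF s(1)] by simp
      then show "s \<in> (\<lambda>(\<sigma>, h). \<sigma> + h) ` (P j \<times> H j)"
        using s(2) by (intro image_eqI[of _ _ "(trunc j s, blk j s)"]) simp_all
    qed
    moreover have "finite (P j \<times> H j)" using finite_subset[OF H_seg finite_seg] by simp
    ultimately have "card (F (Suc j)) \<le> card (P j) * card (H j)"
      using surj_card_le[of "P j \<times> H j" "F (Suc j)"] by (simp add: card_cartesian_product)
    then have "real (card (F (Suc j))) \<le> real (card (P j)) * real (card (H j))"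
      by (simp only: flip: of_nat_mult of_nat_le_iff)
    then have "dens F (Suc j) \<le> real (card (P j)) * real (card (H j)) / (real (card (P j)) * real (card (V j)))"
      unfolding dens_def card_P_Suc of_nat_mult by (rule divide_right_mono) simp
    also have "\<dots> = real (card (H j)) / real (card (V j))"
      by (rule mult_divide_mult_cancel_left) (simp add: card_seg)
    also have "\<dots> \<le> (1/2) ^ j"
    proof -
      have "(1 / 2) ^ j * (real (card (H j)) * 2 ^ j) \<le> (1 / 2) ^ j * real (card (V j))"
        by (rule mult_left_mono[OF card_H]) simp
      moreover have "(1 / 2 :: real) ^ j * (real (card (H j)) * 2 ^ j) = real (card (H j))"
        by (simp add: power_one_over)
      moreover have "0 < real (card (V j))" by (simp add: card_seg)
      ultimately show ?thesis by (simp only: pos_divide_le_eq)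
    qed
    finally show ?thesis .
  qed
  then have bound: "norm (dens F (Suc j)) \<le> (1/2) ^ j" for j by simp
  have "summable (\<lambda>j. dens F (Suc j))"
    by (rule summable_comparison_test'[OF summable_geometric bound]) simp
  then have "summable (dens F)" by (simp only: summable_Suc_iff)
  then have "recurrent F \<in> null_sets cantor_measure" by (rule recurrent_null[OF F_sub])
  moreover have "null_target \<subseteq> recurrent F"
  proof
    fix x assume "x \<in> null_target"
    then have inf: "\<exists>\<^sub>\<infinity>k. blk k x \<in> H k" by (simp add: null_target_def)
    have "blk k (trunc (Suc k) x) = blk k x" for k by (auto simp: proj_def fun_eq_iff)
    then have "trunc (Suc k) x \<in> F (Suc k) \<longleftrightarrow> blk k x \<in> H k" for k by (simp add: F_def)
    moreover have "\<exists>k\<ge>m. blk k x \<in> H k" for m using inf unfolding INFM_nat_le by simp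
    ultimately have "\<exists>k>m. trunc k x \<in> F k" for m by (meson le_imp_less_Suc)
    then show "x \<in> recurrent F" by (simp add: recurrent_def INFM_nat)
  qed
  ultimately show ?thesis by (metis null_sets_cantor_subset)
qed

end

section \<open>The recursion under the continuum hypothesis\<close>

text \<open>The Cantor space has cardinality aleph_1 under CH, and proper initial segments of its
  cardinal well-order are smaller, hence countable.\<close>

lemma CH_well_order:
  assumes continuum_hypothesis
  shows "\<exists>r :: (cantor \<times> cantor) set. wf r \<and> (\<forall>x y. x \<noteq> y \<longrightarrow> (x, y) \<in> r \<or> (y, x) \<in> r) \<and>
    (\<forall>x. countable {y. (y, x) \<in> r})"
proof -
  let ?c = "|UNIV :: cantor set|"
  have "bij_betw (\<lambda>x n. x n = 1) (UNIV :: cantor set) (Func (Field natLeq) (Field ctwo))"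
  proof (rule bij_betwI[where g = "\<lambda>b n. of_bool (b n)"])
    have "Func (Field natLeq) (Field ctwo) = (UNIV :: (nat \<Rightarrow> bool) set)"
      by (auto simp: Func_def Field_natLeq ctwo_def Field_card_of)
    then show "(\<lambda>x n. x n = 1) \<in> (UNIV :: cantor set) \<rightarrow> Func (Field natLeq) (Field ctwo)" by simp
    show "(\<lambda>n. of_bool (x n = 1)) = x" for x :: cantor
    proof
      fix n show "of_bool (x n = 1) = x n" by (cases "x n = 1") simp_all
    qed
  qed (simp_all add: fun_eq_iff)
  then have "?c =o ctwo ^c natLeq"
    unfolding cexp_def by (intro card_of_ordIso[THEN iffD1] exI)
  then have iso: "?c =o cardSuc natLeq"
    using assms unfolding continuum_hypothesis_def by (rule ordIso_transitive)
  have wo: "Well_order ?c" "Field ?c = UNIV"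
    using card_of_Well_order[of "UNIV :: cantor set"] by (simp_all add: Field_card_of)
  define r where "r = ?c - Id"
  have "wf r" using wo unfolding r_def well_order_on_def by simp
  moreover have "(x, y) \<in> r \<or> (y, x) \<in> r" if "x \<noteq> y" for x y
    using wo that unfolding r_def well_order_on_def linear_order_on_def total_on_def by auto
  moreover have "countable {y. (y, x) \<in> r}" for x
  proof -
    have "{y. (y, x) \<in> r} = underS ?c x" by (auto simp: r_def underS_def)
    moreover have "|underS ?c x| <o ?c"
      by (rule card_of_underS[OF card_of_Card_order]) (simp add: Field_card_of)
    then have "|underS ?c x| <o cardSuc natLeq" using iso by (rule ordLess_ordIso_trans)
    then have "|underS ?c x| \<le>o natLeq"
      using cardSuc_ordLeq_ordLess[OF natLeq_Card_order card_of_Card_order] by blast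
    then have "|underS ?c x| \<le>o |UNIV :: nat set|"
      using ordIso_symmetric[OF card_of_nat] by (rule ordLeq_ordIso_trans)
    then have "countable (underS ?c x)"
      unfolding card_of_ordLeq[symmetric] countable_def by blast
    ultimately show ?thesis by (simp only:)
  qed
  ultimately show ?thesis by blast
qed

context block_system
begin

definition side :: "bool \<Rightarrow> 'b \<times> 'b \<Rightarrow> 'b" where
  "side s p = (if s then fst p else snd p)"

lemma branch_refines: "refines p q \<Longrightarrow> branch (side s p) x \<Longrightarrow> branch (side s q) x"
  unfolding refines_def branch_def by (erule (1) eventually_elim2) (auto simp: side_def)

text \<open>Y collects the points already constructed, for which z works directly. Future points are
  known only as branches of A, hence the rational q. The same z must serve both kinds.\<close>

definition guarded :: "(nat \<Rightarrow> cantor set) \<Rightarrow> cantor set \<Rightarrow> (nat \<Rightarrow> cantor set) \<Rightarrow> bool" where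
  "guarded F Y A \<longleftrightarrow> (\<exists>z. (\<forall>y\<in>Y. y + z \<notin> recurrent F) \<and>
    (\<forall>y. branch A y \<longrightarrow> (\<exists>q\<in>cantor_rationals. y + q + z \<notin> recurrent F)))"

text \<open>Each point of Y excludes a null set of z. As Y is countable, the union is a null set,
  which is what the parameter Z of \<open>exists_avoiding_condition\<close> is for.\<close>

lemma exists_guarded_condition:
  assumes cond: "condition A B" and F: "\<And>k. F k \<subseteq> P k" "summable (dens F)" and Y: "countable Y"
  shows "\<exists>A'. (\<forall>k. A' k \<subseteq> A k) \<and> condition A' B \<and> guarded F Y A'"
proof -
  have Z: "{z. \<exists>y\<in>Y. z + y \<in> recurrent F} \<in> null_sets cantor_measure"
    using recurrent_null[OF F] Y by (rule null_UN_translate)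
  obtain z A' where z: "z \<notin> {z. \<exists>y\<in>Y. z + y \<in> recurrent F}" and A': "\<forall>k. A' k \<subseteq> A k" "condition A' B"
    "\<forall>x. branch A' x \<longrightarrow> (\<exists>q\<in>cantor_rationals. x + q + z \<notin> recurrent F)"
    using exists_avoiding_condition[OF cond F Z] by blast
  have "\<forall>y\<in>Y. y + z \<notin> recurrent F" using z unfolding add.commute[of _ z] by simp
  then show ?thesis using A' unfolding guarded_def by blast
qed

text \<open>The point x is chosen before the condition is shrunk and need not be a branch of the
  result, so it joins the points guarded explicitly. The two sides are then shrunk one after the
  other, using symmetry of conditions.\<close>

lemma exists_next_stage:
  assumes C: "countable C" "\<And>p. p \<in> C \<Longrightarrow> condition (fst p) (snd p)"
    "\<And>p q. p \<in> C \<Longrightarrow> q \<in> C \<Longrightarrow> refines p q \<or> refines q p"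
    and Y: "\<And>s. countable (Y s)" and F: "\<And>k. F k \<subseteq> P k"
  shows "\<exists>p x s. condition (fst p) (snd p) \<and> (\<forall>q\<in>C. refines p q \<and> branch (side s q) x) \<and>
    x + w \<in> null_target \<and> (summable (dens F) \<longrightarrow> (\<forall>s'. guarded F (Y s' \<union> {y. y = x \<and> s' = s}) (side s' p)))"
proof -
  obtain p where p: "condition (fst p) (snd p)" "\<And>q. q \<in> C \<Longrightarrow> refines p q"
    using exists_lower_bound[OF C] by blast
  obtain x where x: "branch (fst p) x \<or> branch (snd p) x" "x + w \<in> null_target"
    using exists_branch_into_target[OF p(1)] by blast
  define s where "s = branch (fst p) x"
  have "branch (side s p) x" using x(1) by (auto simp: s_def side_def)
  then have xC: "branch (side s q) x" if "q \<in> C" for q using branch_refines[OF p(2)[OF that]] by blast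
  show ?thesis
  proof (cases "summable (dens F)")
    case False
    then show ?thesis using p x(2) xC by blast
  next
    case True
    let ?Y = "\<lambda>s'. Y s' \<union> {y. y = x \<and> s' = s}"
    have Y': "countable (?Y s')" for s' using Y by (cases "s' = s") simp_all
    obtain A where A: "\<forall>k. A k \<subseteq> fst p k" "condition A (snd p)" "guarded F (?Y True) A"
      using exists_guarded_condition[OF p(1) F True Y'] by blast
    obtain B where B: "\<forall>k. B k \<subseteq> snd p k" "condition B A" "guarded F (?Y False) B"
      using exists_guarded_condition[OF condition_sym[OF A(2)] F True Y'] by blast
    have "refines (A, B) p" using A(1) B(1) by (simp add: refines_def)
    then have "refines (A, B) q" if "q \<in> C" for q using refines_trans p(2)[OF that] by blast
    moreover have "guarded F (?Y s') (side s' (A, B))" for s'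
      using A(3) B(3) by (cases s') (simp_all add: side_def)
    moreover have "condition (fst (A, B)) (snd (A, B))" using condition_sym[OF B(2)] by simp
    ultimately show ?thesis using x(2) xC by blast
  qed
qed

text \<open>Codes of null sets are subsets of a countable set, so points of the Cantor space can
  index them along the well-order.\<close>

lemma exists_coding:
  "\<exists>dec :: cantor \<Rightarrow> nat \<Rightarrow> cantor set. (\<forall>c k. dec c k \<subseteq> P k) \<and> (\<forall>F. (\<forall>k. F k \<subseteq> P k) \<longrightarrow> (\<exists>c. dec c = F))"
proof -
  define X where "X = (SIGMA k:UNIV. P k)"
  have "countable X" unfolding X_def by (intro countable_SIGMA countableI_type countable_finite finite_seg)
  then obtain e :: "nat \<times> cantor \<Rightarrow> nat" where e: "inj_on e X" unfolding countable_def by blast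
  define dec where "dec c k = {s \<in> P k. c (e (k, s)) = (1::bit)}" for c k
  have "\<exists>c. dec c = F" if F: "\<forall>k. F k \<subseteq> P k" for F
  proof -
    define c where "c n = (of_bool (\<exists>k. \<exists>s\<in>F k. e (k, s) = n) :: bit)" for n
    have "dec c k = F k" for k
    proof -
      have "c (e (k, s)) = 1 \<longleftrightarrow> s \<in> F k" if "s \<in> P k" for s
      proof -
        have "(\<exists>k'. \<exists>s'\<in>F k'. e (k', s') = e (k, s)) \<longleftrightarrow> s \<in> F k"
        proof
          assume "\<exists>k'. \<exists>s'\<in>F k'. e (k', s') = e (k, s)"
          then obtain k' s' where *: "s' \<in> F k'" "e (k', s') = e (k, s)" by blast
          have "(k', s') \<in> X" "(k, s) \<in> X" using * F that unfolding X_def by auto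
          with *(2) have "(k', s') = (k, s)" using e by (simp add: inj_on_eq_iff)
          then show "s \<in> F k" using *(1) by simp
        qed blast
        then show ?thesis by (simp add: c_def)
      qed
      then show ?thesis using F unfolding dec_def by blast
    qed
    then show ?thesis by blast
  qed
  moreover have "dec c k \<subseteq> P k" for c k by (auto simp: dec_def)
  ultimately show ?thesis by blast
qed

text \<open>The given null set may first be saturated under \<open>cantor_rationals\<close> and
  stays null. Hence a rational correction that varies with x costs nothing.\<close>

lemma strongly_meagerI:
  assumes "\<And>F. (\<forall>k. F k \<subseteq> P k) \<Longrightarrow> summable (dens F) \<Longrightarrow>
    \<exists>z. \<forall>x\<in>X. \<exists>q\<in>cantor_rationals. x + q + z \<notin> recurrent F"
  shows "strongly_meager X"
  unfolding strongly_meager_def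
proof (intro ballI notI)
  fix G assume G: "G \<in> null_sets cantor_measure" and UNIV: "X + G = UNIV"
  have "{x. \<exists>q\<in>cantor_rationals. x + q \<in> G} \<in> null_sets cantor_measure"
    using G countable_cantor_rationals by (rule null_UN_translate)
  then obtain F where F: "\<forall>k. F k \<subseteq> P k" "summable (dens F)"
    "{x. \<exists>q\<in>cantor_rationals. x + q \<in> G} \<subseteq> recurrent F"
    using null_subset_recurrent by blast
  obtain z where z: "\<And>x. x \<in> X \<Longrightarrow> \<exists>q\<in>cantor_rationals. x + q + z \<notin> recurrent F"
    using assms[OF F(1,2)] by blast
  have "z \<in> X + G" using UNIV by simp
  then obtain x g where xg: "x \<in> X" "g \<in> G" "z = x + g" by (rule set_plus_elim)
  obtain q where q: "q \<in> cantor_rationals" "x + q + z \<notin> recurrent F" using z[OF xg(1)] by blast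
  have "x + q + z + q = g" unfolding xg(3) by (simp only: ac_simps bit_fun_add_cancel bit_fun_add_self add_0_right)
  then have "x + q + z + q \<in> G" using xg(2) by (simp only:)
  then have "x + q + z \<in> {x. \<exists>q\<in>cantor_rationals. x + q \<in> G}" using q(1) by blast
  then show False using F(3) q(2) by blast
qed

text \<open>Stage \<alpha> has to hit \<open>w \<alpha>\<close> and to guard against the code
  \<open>Fs \<alpha>\<close>. The z of stage \<alpha> serves every point on a side: points from
  stages up to \<alpha> are guarded explicitly, and later ones are branches of the condition of
  stage \<alpha>.\<close>

theorem CH_strongly_meager_Un:
  assumes CH: continuum_hypothesis
  shows "\<exists>X1 X2. strongly_meager X1 \<and> strongly_meager X2 \<and> \<not> strongly_meager (X1 \<union> X2)"
proof -
  obtain r :: "(cantor \<times> cantor) set" where r: "wf r" "\<And>x y. x \<noteq> y \<Longrightarrow> (x, y) \<in> r \<or> (y, x) \<in> r"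
    "\<And>x. countable {y. (y, x) \<in> r}"
    using CH_well_order[OF CH] by blast
  obtain dec :: "cantor \<Rightarrow> nat \<Rightarrow> cantor set" where dec: "\<And>c k. dec c k \<subseteq> P k"
    "\<And>F. (\<forall>k. F k \<subseteq> P k) \<Longrightarrow> \<exists>c. dec c = F"
    using exists_coding by blast
  \<comment> \<open>Even coordinates of \<alpha> give the point to be hit and odd ones the code, so
    every combination occurs at some stage.\<close>
  define w :: "cantor \<Rightarrow> cantor" where "w \<alpha> = (\<lambda>n. \<alpha> (2 * n))" for \<alpha>
  define Fs where "Fs \<alpha> = dec (\<lambda>n. \<alpha> (2 * n + 1))" for \<alpha> :: cantor
  have task: "\<exists>\<alpha>. w \<alpha> = v \<and> Fs \<alpha> = dec c" for v c
  proof (intro exI conjI)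
    let ?\<alpha> = "\<lambda>n. if even n then v (n div 2) else c (n div 2)"
    show "w ?\<alpha> = v" by (simp add: w_def)
    show "Fs ?\<alpha> = dec c" by (simp add: Fs_def)
  qed
  define Y where "Y f \<alpha> s = (\<lambda>\<beta>. fst (snd (f \<beta>))) ` {\<beta>. (\<beta>, \<alpha>) \<in> r \<and> snd (snd (f \<beta>)) = s}"
    for f :: "cantor \<Rightarrow> ((nat \<Rightarrow> cantor set) \<times> (nat \<Rightarrow> cantor set)) \<times> cantor \<times> bool" and \<alpha> s
  define \<Phi> where "\<Phi> f \<alpha> v \<longleftrightarrow> condition (fst (fst v)) (snd (fst v)) \<and>
      (\<forall>\<beta>. (\<beta>, \<alpha>) \<in> r \<longrightarrow> refines (fst v) (fst (f \<beta>)) \<and> branch (side (snd (snd v)) (fst (f \<beta>))) (fst (snd v))) \<and>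
      fst (snd v) + w \<alpha> \<in> null_target \<and>
      (summable (dens (Fs \<alpha>)) \<longrightarrow>
        (\<forall>s. guarded (Fs \<alpha>) (Y f \<alpha> s \<union> {y. y = fst (snd v) \<and> s = snd (snd v)}) (side s (fst v))))"
    for f :: "cantor \<Rightarrow> ((nat \<Rightarrow> cantor set) \<times> (nat \<Rightarrow> cantor set)) \<times> cantor \<times> bool" and \<alpha> v
  have "\<exists>f. \<forall>\<alpha>. \<Phi> f \<alpha> (f \<alpha>)"
  proof (rule dependent_wf_choice[OF r(1)])
    fix f g :: "cantor \<Rightarrow> ((nat \<Rightarrow> cantor set) \<times> (nat \<Rightarrow> cantor set)) \<times> cantor \<times> bool" and \<alpha> v
    assume eq: "\<And>\<beta>. (\<beta>, \<alpha>) \<in> r \<Longrightarrow> f \<beta> = g \<beta>"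
    have "Y f \<alpha> s = Y g \<alpha> s" for s
      unfolding Y_def by (intro image_cong Collect_cong conj_cong refl) (simp_all add: eq)
    then show "\<Phi> f \<alpha> v = \<Phi> g \<alpha> v"
      unfolding \<Phi>_def by (intro conj_cong all_cong1 imp_cong refl) (simp_all only: eq)
  next
    fix \<alpha> and f :: "cantor \<Rightarrow> ((nat \<Rightarrow> cantor set) \<times> (nat \<Rightarrow> cantor set)) \<times> cantor \<times> bool"
    assume hist: "\<And>\<beta>. (\<beta>, \<alpha>) \<in> r \<Longrightarrow> \<Phi> f \<beta> (f \<beta>)"
    let ?D = "{\<beta>. (\<beta>, \<alpha>) \<in> r}"
    have ref: "refines (fst (f \<gamma>)) (fst (f \<beta>))" if "(\<beta>, \<gamma>) \<in> r" "(\<gamma>, \<alpha>) \<in> r" for \<beta> \<gamma>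
      using hist[OF that(2), unfolded \<Phi>_def, THEN conjunct2, THEN conjunct1, rule_format, OF that(1)]
      by (rule conjunct1)
    have "\<exists>p x s. condition (fst p) (snd p) \<and> (\<forall>q\<in>(\<lambda>\<beta>. fst (f \<beta>)) ` ?D. refines p q \<and> branch (side s q) x) \<and>
      x + w \<alpha> \<in> null_target \<and>
      (summable (dens (Fs \<alpha>)) \<longrightarrow> (\<forall>s'. guarded (Fs \<alpha>) (Y f \<alpha> s' \<union> {y. y = x \<and> s' = s}) (side s' p)))"
    proof (rule exists_next_stage)
      show "countable ((\<lambda>\<beta>. fst (f \<beta>)) ` ?D)" using r(3) by (rule countable_image)
      show "condition (fst p) (snd p)" if "p \<in> (\<lambda>\<beta>. fst (f \<beta>)) ` ?D" for p
      proof -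
        obtain \<beta> where \<beta>: "p = fst (f \<beta>)" "(\<beta>, \<alpha>) \<in> r" using \<open>p \<in> _\<close> by blast
        show ?thesis using hist[OF \<beta>(2), unfolded \<Phi>_def, THEN conjunct1] by (simp only: \<beta>(1))
      qed
      show "refines p q \<or> refines q p"
        if pq: "p \<in> (\<lambda>\<beta>. fst (f \<beta>)) ` ?D" "q \<in> (\<lambda>\<beta>. fst (f \<beta>)) ` ?D" for p q
      proof -
        obtain \<beta> \<gamma> where \<beta>: "p = fst (f \<beta>)" "(\<beta>, \<alpha>) \<in> r" and \<gamma>: "q = fst (f \<gamma>)" "(\<gamma>, \<alpha>) \<in> r"
          using pq by blast
        show ?thesis
        proof (cases "\<beta> = \<gamma>")
          case True
          then show ?thesis using \<beta> \<gamma> refines_refl by simp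
        next
          case False
          from r(2)[OF this] show ?thesis
            unfolding \<beta>(1) \<gamma>(1) using ref[of \<beta> \<gamma>] ref[of \<gamma> \<beta>] \<beta>(2) \<gamma>(2) by blast
        qed
      qed
      show "countable (Y f \<alpha> s)" for s
      proof -
        have "Y f \<alpha> s \<subseteq> (\<lambda>\<beta>. fst (snd (f \<beta>))) ` ?D" unfolding Y_def by (intro image_mono Collect_mono impI) (rule conjunct1)
        then show ?thesis using countable_image[OF r(3)] by (rule countable_subset)
      qed
      show "Fs \<alpha> k \<subseteq> P k" for k unfolding Fs_def by (rule dec(1))
    qed
    then obtain p x s where pxs: "condition (fst p) (snd p)"
      "\<forall>q\<in>(\<lambda>\<beta>. fst (f \<beta>)) ` ?D. refines p q \<and> branch (side s q) x" "x + w \<alpha> \<in> null_target"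
      "summable (dens (Fs \<alpha>)) \<longrightarrow> (\<forall>s'. guarded (Fs \<alpha>) (Y f \<alpha> s' \<union> {y. y = x \<and> s' = s}) (side s' p))"
      by (elim exE conjE) (rule that)
    have "\<forall>\<beta>. (\<beta>, \<alpha>) \<in> r \<longrightarrow> refines p (fst (f \<beta>)) \<and> branch (side s (fst (f \<beta>))) x"
      using pxs(2) by simp
    with pxs(1,3,4) have "\<Phi> f \<alpha> (p, x, s)"
      unfolding \<Phi>_def fst_conv snd_conv by (intro conjI)
    then show "\<exists>v. \<Phi> f \<alpha> v" by blast
  qed
  then obtain f where f: "\<And>\<alpha>. \<Phi> f \<alpha> (f \<alpha>)" by blast
  define x where "x \<alpha> = fst (snd (f \<alpha>))" for \<alpha>
  define X where "X s = {x \<alpha> | \<alpha>. snd (snd (f \<alpha>)) = s}" for s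
  have "strongly_meager (X s)" for s
  proof (rule strongly_meagerI)
    fix F assume F: "\<forall>k. F k \<subseteq> P k" "summable (dens F)"
    obtain \<alpha> where \<alpha>: "Fs \<alpha> = F" using dec(2)[OF F(1)] task by metis
    have "guarded F (Y f \<alpha> s \<union> {y. y = x \<alpha> \<and> s = snd (snd (f \<alpha>))}) (side s (fst (f \<alpha>)))"
      using f[of \<alpha>] F(2) unfolding \<Phi>_def \<alpha> x_def by blast
    then obtain z where z: "\<And>y. y \<in> Y f \<alpha> s \<union> {y. y = x \<alpha> \<and> s = snd (snd (f \<alpha>))} \<Longrightarrow> y + z \<notin> recurrent F"
      "\<And>y. branch (side s (fst (f \<alpha>))) y \<Longrightarrow> \<exists>q\<in>cantor_rationals. y + q + z \<notin> recurrent F"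
      unfolding guarded_def by blast
    have "\<exists>q\<in>cantor_rationals. y + q + z \<notin> recurrent F" if "y \<in> X s" for y
    proof -
      obtain \<beta> where \<beta>: "y = x \<beta>" "snd (snd (f \<beta>)) = s" using \<open>y \<in> X s\<close> unfolding X_def by blast
      show ?thesis
      proof (cases "(\<alpha>, \<beta>) \<in> r")
        case True
        then have "branch (side s (fst (f \<alpha>))) y"
          using f[of \<beta>] \<beta> unfolding \<Phi>_def x_def by blast
        then show ?thesis by (rule z(2))
      next
        case False
        then have "y \<in> Y f \<alpha> s \<union> {y. y = x \<alpha> \<and> s = snd (snd (f \<alpha>))}"
          using r(2)[of \<alpha> \<beta>] \<beta> unfolding Y_def x_def by blast
        then have "y + 0 + z \<notin> recurrent F" using z(1) by simp
        moreover have "0 \<in> cantor_rationals" by (simp add: cantor_rationals_def)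
        ultimately show ?thesis by blast
      qed
    qed
    then show "\<exists>z. \<forall>x\<in>X s. \<exists>q\<in>cantor_rationals. x + q + z \<notin> recurrent F" by blast
  qed
  moreover have "\<not> strongly_meager (X True \<union> X False)"
  proof -
    have "v \<in> (X True \<union> X False) + null_target" for v
    proof -
      obtain \<alpha> where \<alpha>: "w \<alpha> = v" using task by blast
      have "x \<alpha> \<in> X True \<union> X False" unfolding X_def by (cases "snd (snd (f \<alpha>))") auto
      moreover have "x \<alpha> + v \<in> null_target" using f[of \<alpha>] unfolding \<Phi>_def x_def \<alpha> by blast
      ultimately have "x \<alpha> + (x \<alpha> + v) \<in> (X True \<union> X False) + null_target" by (rule set_plus_intro)
      then show ?thesis by (simp only: bit_fun_add_cancel)
    qed
    then show ?thesis using null_target_null unfolding strongly_meager_def by blast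
  qed
  ultimately show ?thesis by blast
qed

end

theorem theorem2p2:
  fixes H :: "cantor set"
    and P :: "(cantor set \<times> cantor set) set"
    and gen :: "nat \<Rightarrow> cantor set \<times> cantor set \<Rightarrow> cantor set \<times> cantor set \<Rightarrow> bool"
  assumes CH: continuum_hypothesis
    and H: "H \<in> null_sets cantor_measure"
    and P: "P \<subseteq> Perf \<times> Perf"
    and A0: "fusion_property P pair_ge gen"
    and A1: "\<forall>p\<in>P. \<forall>n z. \<exists>q\<in>P. gen n q p \<and> (fst q \<subseteq> z +o H \<or> snd q \<subseteq> z +o H)"
    and A2: "\<forall>p\<in>P. \<forall>n. \<forall>X :: cantor set. \<forall>\<pi>\<in>{fst, snd}. \<forall>t\<in>Perf.
      countable X \<and> emeasure cantor_measure t > 0 \<longrightarrow>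
      emeasure cantor_measure
        {z. \<exists>q\<in>P. gen n q p \<and>
              X \<union> (\<pi> q + cantor_rationals) \<subseteq> z +o (t + cantor_rationals)} = 1"
  shows "\<not> set_ideal {X. strongly_meager X} \<and>
    (\<exists>X1 X2. strongly_meager X1 \<and> strongly_meager X2 \<and> \<not> strongly_meager (X1 \<union> X2))"
proof -
  obtain N H' good where "block_system N H' good" using exists_block_system by blast
  then obtain X1 X2 where "strongly_meager X1" "strongly_meager X2" "\<not> strongly_meager (X1 \<union> X2)"
    using block_system.CH_strongly_meager_Un[OF _ CH] by blast
  then show ?thesis unfolding set_ideal_def by blast
qed

end
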